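(* Let $P=(S_1|\dots|S_k)$ be a partition of a finite set $I$ and let $\mathcal F=(\mathcal T_1|\dots|\mathcal T_k):P\leftarrow Q$ be a layered forest. For $1\le j\le k$ let ${}^IQ_j$ denote the partition of $I$ consisting of the blocks of $Q$ contained in $S_j$ together with the singletons $\{i\}$, $i\in I- S_j$. Then $$\boldsymbol\partial_{\mathcal F}\circ \mathbf{prod}_P=\mathbf{prod}_P\circ(\otimes\boldsymbol\partial_{\mathcal F})$$ as linear maps $\bigotimes_j\mathsf L^{\vee*}[{}^IS_j]\to\mathsf L^{\vee*}[Q]$. Here on the left $\mathbf{prod}_P:\bigotimes_j\mathsf L^{\vee*}[{}^IS_j]\to\mathsf L^{\vee*}[P]$, on the right $\mathbf{prod}_P:\bigotimes_j\mathsf L^{\vee*}[{}^IQ_j]\to\mathsf L^{\vee*}[Q]$, and $\otimes\boldsymbol\partial_{\mathcal F}:\bigotimes_j\mathsf L^{\vee*}[{}^IS_j]\to\bigotimes_j\mathsf L^{\vee*}[{}^IQ_j]$ is the tensor product $f_1\otimes\dots\otimes f_k\mapsto\boldsymbol\partial_1f_1\otimes\dots\otimes\boldsymbol\partial_kf_k$, where $\boldsymbol\partial_j:\mathsf L^{\vee*}[{}^IS_j]\to\mathsf L^{\vee*}[{}^IQ_j]$ is the forest derivative with respect to the layered forest ${}^IS_j\leftarrow{}^IQ_j$ obtained by completing $\mathcal T_j$ (with the layering restricted from $\mathcal F$) with sticks labelled by the singletons $\{i\}$, $i\in I- S_j$.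
   Context: **Arrangement and faces.** $\Bbbk$ is a field of characteristic zero. A partition $P=(S_1|\dots|S_k)$ of $I$ is an unordered set of disjoint nonempty blocks with union $I$; $Q$ is finer than $P$ if every block of $Q$ is contained in a block of $P$ ($Q=P$ allowed). $(I)$ is the one-block partition; for $S\subseteq I$, ${}^IS$ is the partition of $I$ with block $S$ and all other blocks singletons. Put $T^\vee[P]=\{h\in\mathbb R I:\sum_{i\in S_j}h_i=0 \text{ for all } j\}$ and $T^\vee[I]=T^\vee[(I)]$. The adjoint braid arrangement consists of the hyperplanes $\{\sum_{i\in S}h_i=0\}$ of $T^\vee[I]$, for $\emptyset\ne S\subsetneq I$. An adjoint face $X$ is (the characteristic function of) a relatively open face of this arrangement; it is determined by its sign function $s_X$, where $s_X(S)\in\{+,-,0\}$ is the sign of $\sum_{i\in S}h_i$ for $h$ in the face, $\emptyset\neq S\subsetneq I$. Its support is the linear span of the face. $\mathsf L^\vee[P]$ is the $\Bbbk$-vector space with basis the adjoint faces with support $T^\vee[P]$; $\mathsf L^{\vee *}[P]$ is its dual, whose elements are called functionals. **External product.** Let $P=(S_1|\dots|S_k)$ and let $Q$ be finer than $P$. For an adjoint face $X\in\mathsf L^\vee[Q]$, $X|_{S_j}\in\mathsf L^\vee[{}^IQ_j]$ is the adjoint face with sign $S\mapsto s_X(S\cap S_j)$ if $S\cap S_j\ne\emptyset$, and $0$ if $S\cap S_j=\emptyset$. Then $\mathbf{prod}_P:\bigotimes_j\mathsf L^{\vee*}[{}^IQ_j]\to\mathsf L^{\vee*}[Q]$ is given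 by $\mathbf{prod}_P(f_1\otimes\dots\otimes f_k)(X)=\prod_jf_j(X|_{S_j})$. (For $Q=P$ one has ${}^IQ_j={}^IS_j$.) **Forests and forest derivative.** A tree over a finite set $S$ is a planar full binary tree whose leaves are labelled bijectively by the blocks of a partition of $S$; a one-leaf tree is a stick. A layered forest $\mathcal F=(\mathcal T_1|\dots|\mathcal T_k):P\leftarrow Q$ is a family of trees, $\mathcal T_j$ over $S_j$, whose leaves are labelled bijectively by the blocks of $Q$, together with a linear order (layering) on all the (internal) nodes in which each node precedes its descendants. For $E\subseteq I$, $\mathrm{Redn}_P(E)$ is $E$ with all blocks of $P$ contained in $E$ removed; write $E=S \bmod P$ if $\mathrm{Redn}_P(E)=\mathrm{Redn}_P(S)$. A cut $\mathcal V=[C,D]:P\leftarrow Q$ is a forest with exactly one node: an ordered splitting of one block $S_m=C\sqcup D$ of $P$ ($C,D\neq\emptyset$; $C$ on the left, $D$ on the right), where $Q$ is $P$ with $S_m$ replaced by $C$ and $D$; $\overline{\mathcal V}=[D,C]$. For an adjoint face $X\in\mathsf L^\vee[Q]$, $X^{\mathcal V}\in\mathsf L^\vee[P]$ is the adjoint face with sign at $S$ equal to $+$ if $S=C\bmod P$, $-$ if $S=D\bmod P$, $s_X(S)$ if $S\ne\emptyset\bmod Q$, and $0$ if $S=\emptyset\bmod P$. For $f\in\mathsf L^{\vee*}[P]$ set $\boldsymbol\partial_{\mathcal V}f(X)=f(X^{\mathcal V})-f(X^{\overline{\mathcal V}})$. Every layered forest decomposes uniquely as a sequence of successive cuts $\mathcal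 F=\mathcal V_1\circ\dots\circ\mathcal V_l$ in the order of its nodes (starting from $P$, ending at $Q$). Set $\boldsymbol\partial_{\mathcal F}f=\boldsymbol\partial_{\mathcal V_l}(\cdots(\boldsymbol\partial_{\mathcal V_1}f)\cdots)$; if $l=0$ this is the identity. *)

theory Defs
  imports Complex_Main "HOL-Library.Disjoint_Sets" "HOL-Library.FuncSet" "HOL-Library.Function_Algebras"
begin

section \<open>Linear algebra on function spaces\<close>

text \<open>Vector spaces occur as subspaces of function spaces \<^typ>\<open>'b \<Rightarrow> 'k\<close> with the pointwise
  operations (addition is the instance from \<^theory>\<open>HOL-Library.Function_Algebras\<close>).\<close>

definition fscale :: "'k::field \<Rightarrow> ('b \<Rightarrow> 'k) \<Rightarrow> ('b \<Rightarrow> 'k)"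
  where "fscale c f = (\<lambda>x. c * f x)"

global_interpretation fun_vs: vector_space "fscale :: 'k::field \<Rightarrow> ('b \<Rightarrow> 'k) \<Rightarrow> ('b \<Rightarrow> 'k)"
  by unfold_locales (auto simp: fscale_def fun_eq_iff algebra_simps)

text \<open>The space with basis \<open>B\<close>; the basis vector given by \<open>b \<in> B\<close> is its characteristic
  function \<open>basis_vec b\<close>.\<close>

definition free_space :: "'b set \<Rightarrow> ('b \<Rightarrow> 'k::field) set"
  where "free_space B = {x. finite {b. x b \<noteq> 0} \<and> (\<forall>b. b \<notin> B \<longrightarrow> x b = 0)}"

definition basis_vec :: "'b \<Rightarrow> ('b \<Rightarrow> 'k::field)"
  where "basis_vec b = (\<lambda>b'. if b' = b then 1 else 0)"

text \<open>Linear functionals on a subspace \<open>V\<close>, extended by zero outside \<open>V\<close> so that they are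
  determined by their restriction to \<open>V\<close>.\<close>

definition dual_space :: "('b \<Rightarrow> 'k::field) set \<Rightarrow> (('b \<Rightarrow> 'k) \<Rightarrow> 'k) set"
  where "dual_space V = {f. (\<forall>x\<in>V. \<forall>y\<in>V. f (x + y) = f x + f y)
                          \<and> (\<forall>c. \<forall>x\<in>V. f (fscale c x) = c * f x)
                          \<and> (\<forall>x. x \<notin> V \<longrightarrow> f x = 0)}"

text \<open>The functional on \<open>free_space B\<close> with prescribed values on the basis \<open>B\<close>.\<close>

definition functional :: "'b set \<Rightarrow> ('b \<Rightarrow> 'k::field) \<Rightarrow> (('b \<Rightarrow> 'k) \<Rightarrow> 'k)"
  where "functional B g = (\<lambda>x. if x \<in> free_space B then (\<Sum>b | x b \<noteq> 0. x b * g b) else 0)"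

section \<open>Tensor product of a family of vector spaces\<close>

text \<open>\<open>tensor J V\<close> is the quotient of the free space on the families \<open>f \<in> PiE J V\<close> by the
  subspace generated by the relations of multilinearity; its elements are cosets.\<close>

definition tensor_relations ::
    "'j set \<Rightarrow> ('j \<Rightarrow> ('b \<Rightarrow> 'k::field) set) \<Rightarrow> (('j \<Rightarrow> 'b \<Rightarrow> 'k) \<Rightarrow> 'k) set"
  where "tensor_relations J V = fun_vs.span
     ({basis_vec (f(j := u + v)) - basis_vec (f(j := u)) - basis_vec (f(j := v)) | f j u v.
         f \<in> PiE J V \<and> j \<in> J \<and> u \<in> V j \<and> v \<in> V j}
    \<union> {basis_vec (f(j := fscale c u)) - fscale c (basis_vec (f(j := u))) | f j u c.
         f \<in> PiE J V \<and> j \<in> J \<and> u \<in> V j})"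

definition tensor_rel ::
    "'j set \<Rightarrow> ('j \<Rightarrow> ('b \<Rightarrow> 'k::field) set)
     \<Rightarrow> ((('j \<Rightarrow> 'b \<Rightarrow> 'k) \<Rightarrow> 'k) \<times> (('j \<Rightarrow> 'b \<Rightarrow> 'k) \<Rightarrow> 'k)) set"
  where "tensor_rel J V = {(x, y). x \<in> free_space (PiE J V) \<and> y \<in> free_space (PiE J V)
                                 \<and> x - y \<in> tensor_relations J V}"

definition tensor ::
    "'j set \<Rightarrow> ('j \<Rightarrow> ('b \<Rightarrow> 'k::field) set) \<Rightarrow> (('j \<Rightarrow> 'b \<Rightarrow> 'k) \<Rightarrow> 'k) set set"
  where "tensor J V = free_space (PiE J V) // tensor_rel J V"

definition pure_tensor ::
    "'j set \<Rightarrow> ('j \<Rightarrow> ('b \<Rightarrow> 'k::field) set) \<Rightarrow> ('j \<Rightarrow> 'b \<Rightarrow> 'k) \<Rightarrow> (('j \<Rightarrow> 'b \<Rightarrow> 'k) \<Rightarrow> 'k) set"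
  where "pure_tensor J V f = tensor_rel J V `` {basis_vec f}"

definition lin_comb :: "('c \<Rightarrow> 'd \<Rightarrow> 'k::field) \<Rightarrow> ('c \<Rightarrow> 'k) \<Rightarrow> ('d \<Rightarrow> 'k)"
  where "lin_comb m x = (\<Sum>f | x f \<noteq> 0. fscale (x f) (m f))"

text \<open>The linear map on \<open>tensor J V\<close> induced by a multilinear map \<open>m\<close> into a function space;
  by multilinearity the value does not depend on the chosen representative
  (see \<open>tensor_lift_pure\<close> below).\<close>

definition tensor_lift ::
    "(('j \<Rightarrow> 'b \<Rightarrow> 'k) \<Rightarrow> 'd \<Rightarrow> 'k::field) \<Rightarrow> (('j \<Rightarrow> 'b \<Rightarrow> 'k) \<Rightarrow> 'k) set \<Rightarrow> ('d \<Rightarrow> 'k)"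
  where "tensor_lift m t = lin_comb m (SOME x. x \<in> t)"

text \<open>The tensor product of linear maps \<open>D j\<close> from \<open>V j\<close> to \<open>W j\<close>, a map from \<open>tensor J V\<close> to
  \<open>tensor J W\<close>: it sends the class of \<open>f\<close> to the class of \<open>\<lambda>j\<in>J. D j (f j)\<close>
  (see \<open>tensor_map_pure\<close> below).\<close>

definition tensor_map ::
    "'j set \<Rightarrow> ('j \<Rightarrow> ('b \<Rightarrow> 'k::field) set) \<Rightarrow> ('j \<Rightarrow> ('b \<Rightarrow> 'k) \<Rightarrow> ('b \<Rightarrow> 'k))
     \<Rightarrow> (('j \<Rightarrow> 'b \<Rightarrow> 'k) \<Rightarrow> 'k) set \<Rightarrow> (('j \<Rightarrow> 'b \<Rightarrow> 'k) \<Rightarrow> 'k) set"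
  where "tensor_map J W D t =
    tensor_rel J W `` {tensor_lift (\<lambda>f. basis_vec (\<lambda>j\<in>J. D j (f j))) t}"

section \<open>The adjoint braid arrangement\<close>

definition singleton_completion :: "'a set \<Rightarrow> 'a set \<Rightarrow> 'a set set"
  where "singleton_completion I S = insert S ((\<lambda>i. {i}) ` (I - S))"

definition partition_at :: "'a set \<Rightarrow> 'a set set \<Rightarrow> 'a set \<Rightarrow> 'a set set"
  where "partition_at I Q S = {B \<in> Q. B \<subseteq> S} \<union> (\<lambda>i. {i}) ` (I - S)"

text \<open>\<open>\<real>I\<close> is the space of real functions vanishing outside \<open>I\<close>.\<close>

definition T_dual :: "'a set \<Rightarrow> 'a set set \<Rightarrow> ('a \<Rightarrow> real) set"
  where "T_dual I P = {h. (\<forall>i. i \<notin> I \<longrightarrow> h i = 0) \<and> (\<forall>S\<in>P. sum h S = 0)}"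

text \<open>Relatively open faces of the arrangement: the nonempty sets of all points having the same
  position with respect to every hyperplane.\<close>

type_synonym 'a face = "('a \<Rightarrow> real) set"

definition adjoint_faces :: "'a set \<Rightarrow> 'a face set"
  where "adjoint_faces I =
    {{h' \<in> T_dual I {I}. \<forall>S. S \<noteq> {} \<and> S \<subset> I \<longrightarrow> sgn (sum h' S) = sgn (sum h S)} | h.
       h \<in> T_dual I {I}}"

definition face_sign :: "'a face \<Rightarrow> 'a set \<Rightarrow> real"
  where "face_sign X S = sgn (sum (SOME h. h \<in> X) S)"

definition faces_on :: "'a set \<Rightarrow> 'a set set \<Rightarrow> 'a face set"
  where "faces_on I P = {X \<in> adjoint_faces I. fun_vs.span X = T_dual I P}"

abbreviation L_space :: "'a set \<Rightarrow> 'a set set \<Rightarrow> ('a face \<Rightarrow> 'k::field) set"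
  where "L_space I P \<equiv> free_space (faces_on I P)"

abbreviation L_dual :: "'a set \<Rightarrow> 'a set set \<Rightarrow> (('a face \<Rightarrow> 'k::field) \<Rightarrow> 'k) set"
  where "L_dual I P \<equiv> dual_space (L_space I P)"

section \<open>The external product\<close>

definition face_restrict :: "'a set \<Rightarrow> 'a set set \<Rightarrow> 'a face \<Rightarrow> 'a set \<Rightarrow> 'a face"
  where "face_restrict I Q X B = (THE Y. Y \<in> faces_on I (partition_at I Q B) \<and>
     (\<forall>S. S \<noteq> {} \<and> S \<subset> I \<longrightarrow>
        face_sign Y S = (if S \<inter> B \<noteq> {} then face_sign X (S \<inter> B) else 0)))"

definition prod_on_pure ::
    "'a set \<Rightarrow> 'a set set \<Rightarrow> 'a set set \<Rightarrow> ('a set \<Rightarrow> ('a face \<Rightarrow> 'k) \<Rightarrow> 'k)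
     \<Rightarrow> ('a face \<Rightarrow> 'k::field) \<Rightarrow> 'k"
  where "prod_on_pure I P Q f =
    functional (faces_on I Q) (\<lambda>X. \<Prod>B\<in>P. f B (basis_vec (face_restrict I Q X B)))"

text \<open>\<open>ext_prod I P Q\<close> is the external product of \<open>P\<close> with values in \<open>L_dual I Q\<close>, for \<open>Q\<close> finer
  than \<open>P\<close>.\<close>

definition ext_prod ::
    "'a set \<Rightarrow> 'a set set \<Rightarrow> 'a set set \<Rightarrow> (('a set \<Rightarrow> ('a face \<Rightarrow> 'k) \<Rightarrow> 'k) \<Rightarrow> 'k) set
     \<Rightarrow> ('a face \<Rightarrow> 'k::field) \<Rightarrow> 'k"
  where "ext_prod I P Q = tensor_lift (prod_on_pure I P Q)"

section \<open>Layered forests\<close>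

datatype 'a tree = Stick "'a set" | Node "'a tree" "'a tree"

primrec leaf_labels :: "'a tree \<Rightarrow> 'a set list" where
  "leaf_labels (Stick B) = [B]"
| "leaf_labels (Node l r) = leaf_labels l @ leaf_labels r"

definition tree_over :: "'a set \<Rightarrow> 'a tree \<Rightarrow> bool"
  where "tree_over S t \<longleftrightarrow> distinct (leaf_labels t) \<and> partition_on S (set (leaf_labels t))"

text \<open>An internal node is identified with the subtree rooted at it. For trees over a set this is
  faithful: the leaf labels are distinct, so different nodes have different subtrees.\<close>

primrec nodes :: "'a tree \<Rightarrow> 'a tree set" where
  "nodes (Stick B) = {}"
| "nodes (Node l r) = insert (Node l r) (nodes l \<union> nodes r)"

text \<open>A layered forest consists of a tree for every block of \<open>P\<close> (values outside \<open>P\<close> are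
  irrelevant) and the list of all nodes in the order given by the layering.\<close>

type_synonym 'a forest = "('a set \<Rightarrow> 'a tree) \<times> 'a tree list"

definition layered_forest :: "'a set \<Rightarrow> 'a set set \<Rightarrow> 'a set set \<Rightarrow> 'a forest \<Rightarrow> bool"
  where "layered_forest I P Q F \<longleftrightarrow> (case F of (T, ns) \<Rightarrow>
     partition_on I P
   \<and> (\<forall>S\<in>P. tree_over S (T S))
   \<and> Q = (\<Union>S\<in>P. set (leaf_labels (T S)))
   \<and> distinct ns \<and> set ns = (\<Union>S\<in>P. nodes (T S))
   \<and> (\<forall>i<length ns. \<forall>j<length ns. ns ! j \<in> nodes (ns ! i) \<longrightarrow> i \<le> j))"

text \<open>The tree of \<open>F\<close> at the block \<open>S\<close>, completed with sticks and with the layering restricted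
  from \<open>F\<close>.\<close>

definition forest_at :: "'a forest \<Rightarrow> 'a set \<Rightarrow> 'a forest"
  where "forest_at F S = (case F of (T, ns) \<Rightarrow>
     ((\<lambda>B. if B = S then T S else Stick B), filter (\<lambda>n. n \<in> nodes (T S)) ns))"

section \<open>The forest derivative\<close>

definition redn :: "'a set set \<Rightarrow> 'a set \<Rightarrow> 'a set"
  where "redn P E = E - \<Union>{B \<in> P. B \<subseteq> E}"

definition eq_mod :: "'a set set \<Rightarrow> 'a set \<Rightarrow> 'a set \<Rightarrow> bool"
  where "eq_mod P E S \<longleftrightarrow> redn P E = redn P S"

text \<open>A cut \<open>[C, D]\<close> of the block \<open>C \<union> D\<close> of \<open>P\<close> is given by the pair \<open>(C, D)\<close>.\<close>

definition cut_target :: "'a set set \<Rightarrow> 'a set \<times> 'a set \<Rightarrow> 'a set set"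
  where "cut_target P V = (case V of (C, D) \<Rightarrow> (P - {C \<union> D}) \<union> {C, D})"

definition cut_face :: "'a set \<Rightarrow> 'a set set \<Rightarrow> 'a set \<times> 'a set \<Rightarrow> 'a face \<Rightarrow> 'a face"
  where "cut_face I P V X = (case V of (C, D) \<Rightarrow>
    (THE Y. Y \<in> faces_on I P \<and> (\<forall>S. S \<noteq> {} \<and> S \<subset> I \<longrightarrow>
        (eq_mod P S C \<longrightarrow> face_sign Y S = 1)
      \<and> (eq_mod P S D \<longrightarrow> face_sign Y S = - 1)
      \<and> (\<not> eq_mod (cut_target P V) S {} \<longrightarrow> face_sign Y S = face_sign X S)
      \<and> (eq_mod P S {} \<longrightarrow> face_sign Y S = 0))))"

definition cut_deriv ::
    "'a set \<Rightarrow> 'a set set \<Rightarrow> 'a set \<times> 'a set \<Rightarrow> (('a face \<Rightarrow> 'k) \<Rightarrow> 'k) \<Rightarrow> ('a face \<Rightarrow> 'k::field) \<Rightarrow> 'k"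
  where "cut_deriv I P V f = functional (faces_on I (cut_target P V))
    (\<lambda>X. f (basis_vec (cut_face I P V X)) - f (basis_vec (cut_face I P (prod.swap V) X)))"

primrec cuts_deriv ::
    "'a set \<Rightarrow> 'a set set \<Rightarrow> ('a set \<times> 'a set) list \<Rightarrow> (('a face \<Rightarrow> 'k) \<Rightarrow> 'k) \<Rightarrow> ('a face \<Rightarrow> 'k::field) \<Rightarrow> 'k"
where
  "cuts_deriv I P [] f = f"
| "cuts_deriv I P (V # Vs) f = cuts_deriv I (cut_target P V) Vs (cut_deriv I P V f)"

primrec node_cut :: "'a tree \<Rightarrow> 'a set \<times> 'a set" where
  "node_cut (Stick B) = undefined"
| "node_cut (Node l r) = (\<Union>(set (leaf_labels l)), \<Union>(set (leaf_labels r)))"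

definition forest_deriv ::
    "'a set \<Rightarrow> 'a set set \<Rightarrow> 'a forest \<Rightarrow> (('a face \<Rightarrow> 'k) \<Rightarrow> 'k) \<Rightarrow> ('a face \<Rightarrow> 'k::field) \<Rightarrow> 'k"
  where "forest_deriv I P F = cuts_deriv I P (map node_cut (snd F))"

section \<open>Values on pure tensors\<close>

definition multilinear_on ::
    "'j set \<Rightarrow> ('j \<Rightarrow> ('b \<Rightarrow> 'k::field) set) \<Rightarrow> (('j \<Rightarrow> 'b \<Rightarrow> 'k) \<Rightarrow> 'd \<Rightarrow> 'k) \<Rightarrow> bool"
  where "multilinear_on J V m \<longleftrightarrow>
     (\<forall>f\<in>PiE J V. \<forall>j\<in>J. \<forall>u\<in>V j. \<forall>v\<in>V j. m (f(j := u + v)) = m (f(j := u)) + m (f(j := v)))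
   \<and> (\<forall>f\<in>PiE J V. \<forall>j\<in>J. \<forall>u\<in>V j. \<forall>c. m (f(j := fscale c u)) = fscale c (m (f(j := u))))"

lemma lin_comb_superset:
  assumes "finite A" "{f. x f \<noteq> 0} \<subseteq> A"
  shows "lin_comb m x = (\<Sum>f\<in>A. fscale (x f) (m f))"
  unfolding lin_comb_def using assms
  by (intro sum.mono_neutral_left) (auto simp: fscale_def fun_eq_iff)

lemma lin_comb_basis_vec: "lin_comb m (basis_vec f) = m f"
  by (subst lin_comb_superset[where A = "{f}"]) (auto simp: basis_vec_def fscale_def)

lemma finite_supp_add:
  fixes x y :: "'c \<Rightarrow> 'k::field"
  assumes "finite {f. x f \<noteq> 0}" "finite {f. y f \<noteq> 0}"
  shows "finite {f. (x + y) f \<noteq> 0}"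
  by (rule finite_subset[OF _ finite_UnI[OF assms]]) auto

lemma lin_comb_add:
  assumes "finite {f. x f \<noteq> 0}" "finite {f. y f \<noteq> 0}"
  shows "lin_comb m (x + y) = lin_comb m x + lin_comb m y"
proof -
  let ?A = "{f. x f \<noteq> 0} \<union> {f. y f \<noteq> 0}"
  have A: "finite ?A" using assms by blast
  have "lin_comb m (x + y) = (\<Sum>f\<in>?A. fscale ((x + y) f) (m f))"
    by (rule lin_comb_superset[OF A]) auto
  also have "\<dots> = (\<Sum>f\<in>?A. fscale (x f) (m f)) + (\<Sum>f\<in>?A. fscale (y f) (m f))"
    by (simp add: fun_vs.scale_left_distrib sum.distrib)
  also have "\<dots> = lin_comb m x + lin_comb m y"
    using lin_comb_superset[OF A, of x m] lin_comb_superset[OF A, of y m] by auto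
  finally show ?thesis .
qed

lemma lin_comb_zero: "lin_comb m 0 = 0"
  by (simp add: lin_comb_def)

lemma lin_comb_scale:
  assumes "finite {f. x f \<noteq> 0}"
  shows "lin_comb m (fscale c x) = fscale c (lin_comb m x)"
proof -
  have "lin_comb m (fscale c x) = (\<Sum>f | x f \<noteq> 0. fscale (fscale c x f) (m f))"
    by (rule lin_comb_superset[OF assms]) (auto simp: fscale_def)
  also have "\<dots> = fscale c (lin_comb m x)"
    unfolding lin_comb_def fun_vs.scale_sum_right
    by (intro sum.cong) (auto simp: fscale_def fun_eq_iff mult.assoc)
  finally show ?thesis .
qed

lemma finite_supp_basis_vec: "finite {f. basis_vec g f \<noteq> 0}"
  by (rule finite_subset[of _ "{g}"]) (auto simp: basis_vec_def)

lemma finite_supp_scale: "finite {f. x f \<noteq> 0} \<Longrightarrow> finite {f. fscale c x f \<noteq> 0}"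
  by (erule finite_subset[rotated]) (auto simp: fscale_def)

lemma diff_conv_fscale: "x - y = x + fscale (- 1) y"
  by (auto simp: fscale_def fun_eq_iff)

lemma lin_comb_tensor_relations:
  assumes m: "multilinear_on J V m" and x: "x \<in> tensor_relations J V"
  shows "finite {f. x f \<noteq> 0} \<and> lin_comb m x = 0"
  using x unfolding tensor_relations_def
proof (induction rule: fun_vs.span_induct_alt)
  case base
  then show ?case by (simp add: lin_comb_def)
next
  case (step c x y)
  have "finite {f. x f \<noteq> 0} \<and> lin_comb m x = 0"
    using step(1)
  proof (elim UnE CollectE exE conjE)
    fix f j u v assume *: "x = basis_vec (f(j := u + v)) - basis_vec (f(j := u)) - basis_vec (f(j := v))"
      "f \<in> PiE J V" "j \<in> J" "u \<in> V j" "v \<in> V j"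
    then have "m (f(j := u + v)) = m (f(j := u)) + m (f(j := v))"
      using m by (auto simp: multilinear_on_def)
    then show ?thesis
      unfolding *(1) diff_conv_fscale
      by (simp only: lin_comb_add lin_comb_scale finite_supp_add finite_supp_scale
          finite_supp_basis_vec lin_comb_basis_vec)
        (auto simp: fscale_def fun_eq_iff)
  next
    fix f j u c assume *: "x = basis_vec (f(j := fscale c u)) - fscale c (basis_vec (f(j := u)))"
      "f \<in> PiE J V" "j \<in> J" "u \<in> V j"
    then have "m (f(j := fscale c u)) = fscale c (m (f(j := u)))"
      using m by (auto simp: multilinear_on_def)
    then show ?thesis
      unfolding *(1) diff_conv_fscale
      by (simp only: lin_comb_add lin_comb_scale finite_supp_add finite_supp_scale
          finite_supp_basis_vec lin_comb_basis_vec)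
        (auto simp: fscale_def fun_eq_iff)
  qed
  with step(2) show ?case
    by (simp only: lin_comb_add lin_comb_scale finite_supp_add finite_supp_scale) auto
qed

lemma tensor_lift_pure:
  assumes m: "multilinear_on J V m" and f: "f \<in> PiE J V"
  shows "tensor_lift m (pure_tensor J V f) = m f"
proof -
  define x where "x = (SOME x. x \<in> pure_tensor J V f)"
  have "basis_vec f \<in> pure_tensor J V f"
    using f finite_supp_basis_vec[of f]
    by (auto simp: pure_tensor_def tensor_rel_def free_space_def tensor_relations_def
        fun_vs.span_zero basis_vec_def)
  then have "x \<in> pure_tensor J V f" unfolding x_def by (rule someI[of "\<lambda>x. x \<in> pure_tensor J V f"])
  then have R: "basis_vec f - x \<in> tensor_relations J V" and fin: "finite {f. x f \<noteq> 0}"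
    by (auto simp: pure_tensor_def tensor_rel_def free_space_def)
  have "basis_vec f = x + (basis_vec f - x)" by simp
  then have "lin_comb m (basis_vec f) = lin_comb m x + 0"
    using lin_comb_add[OF fin, of "basis_vec f - x" m] lin_comb_tensor_relations[OF m R] by metis
  then show ?thesis by (simp add: tensor_lift_def lin_comb_basis_vec flip: x_def)
qed

lemma subspace_free_space: "fun_vs.subspace (free_space B)"
  unfolding fun_vs.subspace_def free_space_def
  using finite_supp_add finite_supp_scale by (fastforce simp: fscale_def)

lemma restrict_fun_upd_apply:
  "k \<in> J \<Longrightarrow> (\<lambda>j\<in>J. D j ((f(k := u)) j)) = (\<lambda>j\<in>J. D j (f j))(k := D k u)"
  by (auto simp: fun_eq_iff)

lemma lin_comb_basis_vec_tensor_relations: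
  assumes D: "\<And>j. j \<in> J \<Longrightarrow> D j \<in> V j \<rightarrow> W j"
    and add: "\<And>j u v. j \<in> J \<Longrightarrow> u \<in> V j \<Longrightarrow> v \<in> V j \<Longrightarrow> D j (u + v) = D j u + D j v"
    and scale: "\<And>j u c. j \<in> J \<Longrightarrow> u \<in> V j \<Longrightarrow> D j (fscale c u) = fscale c (D j u)"
    and x: "x \<in> tensor_relations J V"
  shows "finite {f. x f \<noteq> 0}
       \<and> lin_comb (\<lambda>f. basis_vec (\<lambda>j\<in>J. D j (f j))) x \<in> tensor_relations J W"
  using x unfolding tensor_relations_def[of J V]
proof (induction rule: fun_vs.span_induct_alt)
  case base
  have "0 \<in> tensor_relations J W"
    unfolding tensor_relations_def by (rule fun_vs.span_zero)
  then show ?case by (intro conjI) (simp, simp only: lin_comb_zero)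
next
  case (step c x y)
  let ?m = "\<lambda>f. basis_vec (\<lambda>j\<in>J. D j (f j))"
  have D': "(\<lambda>j\<in>J. D j (f j)) \<in> PiE J W" if "f \<in> PiE J V" for f
    using that D by (fastforce simp: PiE_iff)
  have "finite {f. x f \<noteq> 0} \<and> lin_comb ?m x \<in> tensor_relations J W"
    using step(1)
  proof (elim UnE CollectE exE conjE)
    fix f j u v
    assume *: "x = basis_vec (f(j := u + v)) - basis_vec (f(j := u)) - basis_vec (f(j := v))"
      "f \<in> PiE J V" "j \<in> J" "u \<in> V j" "v \<in> V j"
    let ?g = "\<lambda>j\<in>J. D j (f j)"
    have eq: "lin_comb ?m x = basis_vec (?g(j := D j u + D j v)) - basis_vec (?g(j := D j u))
        - basis_vec (?g(j := D j v))"
      unfolding *(1) diff_conv_fscale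
      by (simp only: lin_comb_add lin_comb_scale finite_supp_add finite_supp_scale
          finite_supp_basis_vec lin_comb_basis_vec restrict_fun_upd_apply[OF *(3)] add[OF *(3-5)])
    have "lin_comb ?m x \<in> tensor_relations J W"
      unfolding eq tensor_relations_def
      by (rule fun_vs.span_base, rule UnI1) (use D'[OF *(2)] D[OF *(3)] *(3-5) in blast)
    then show ?thesis
      unfolding *(1) diff_conv_fscale
      by (simp only: finite_supp_add finite_supp_scale finite_supp_basis_vec simp_thms)
  next
    fix f j u c
    assume *: "x = basis_vec (f(j := fscale c u)) - fscale c (basis_vec (f(j := u)))"
      "f \<in> PiE J V" "j \<in> J" "u \<in> V j"
    let ?g = "\<lambda>j\<in>J. D j (f j)"
    have eq: "lin_comb ?m x = basis_vec (?g(j := fscale c (D j u))) - fscale c (basis_vec (?g(j := D j u)))"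
      unfolding *(1) diff_conv_fscale
      by (simp only: lin_comb_add lin_comb_scale finite_supp_add finite_supp_scale
          finite_supp_basis_vec lin_comb_basis_vec restrict_fun_upd_apply[OF *(3)] scale[OF *(3-4)])
    have "lin_comb ?m x \<in> tensor_relations J W"
      unfolding eq tensor_relations_def
      by (rule fun_vs.span_base, rule UnI2) (use D'[OF *(2)] D[OF *(3)] *(3-4) in blast)
    then show ?thesis
      unfolding *(1) diff_conv_fscale
      by (simp only: finite_supp_add finite_supp_scale finite_supp_basis_vec simp_thms)
  qed
  with step(2) show ?case
    by (simp only: lin_comb_add lin_comb_scale finite_supp_add finite_supp_scale)
      (unfold tensor_relations_def, blast intro: fun_vs.span_add fun_vs.span_scale)
qed

lemma tensor_map_pure:
  assumes D: "\<And>j. j \<in> J \<Longrightarrow> D j \<in> V j \<rightarrow> W j"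
    and add: "\<And>j u v. j \<in> J \<Longrightarrow> u \<in> V j \<Longrightarrow> v \<in> V j \<Longrightarrow> D j (u + v) = D j u + D j v"
    and scale: "\<And>j u c. j \<in> J \<Longrightarrow> u \<in> V j \<Longrightarrow> D j (fscale c u) = fscale c (D j u)"
    and f: "f \<in> PiE J V"
  shows "tensor_map J W D (pure_tensor J V f) = pure_tensor J W (\<lambda>j\<in>J. D j (f j))"
proof -
  let ?m = "\<lambda>f. basis_vec (\<lambda>j\<in>J. D j (f j))"
  define x where "x = (SOME x. x \<in> pure_tensor J V f)"
  have "basis_vec f \<in> pure_tensor J V f"
    using f finite_supp_basis_vec[of f]
    by (auto simp: pure_tensor_def tensor_rel_def free_space_def tensor_relations_def
        fun_vs.span_zero basis_vec_def)
  then have "x \<in> pure_tensor J V f" unfolding x_def by (rule someI[of "\<lambda>x. x \<in> pure_tensor J V f"])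
  then have R: "basis_vec f - x \<in> tensor_relations J V" and fin: "finite {f. x f \<noteq> 0}"
    and supp: "\<And>f. f \<notin> PiE J V \<Longrightarrow> x f = 0"
    by (auto simp: pure_tensor_def tensor_rel_def free_space_def)
  have R': "lin_comb ?m (basis_vec f - x) \<in> tensor_relations J W"
    and fin': "finite {g. (basis_vec f - x) g \<noteq> 0}"
    using lin_comb_basis_vec_tensor_relations[OF D add scale R] by blast+
  have "x + (basis_vec f - x) = basis_vec f" by simp
  then have "?m f = lin_comb ?m x + lin_comb ?m (basis_vec f - x)"
    using lin_comb_add[OF fin fin', of ?m] by (simp only: lin_comb_basis_vec)
  then have R'': "?m f - lin_comb ?m x \<in> tensor_relations J W"
    using R' by simp
  have D': "(\<lambda>j\<in>J. D j (f j)) \<in> PiE J W" if "f \<in> PiE J V" for f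
    using that D by (fastforce simp: PiE_iff)
  have m_free: "?m g \<in> free_space (PiE J W)" if "g \<in> PiE J V" for g
    using D'[OF that] finite_supp_basis_vec[of "\<lambda>j\<in>J. D j (g j)"]
    by (auto simp: free_space_def basis_vec_def)
  have x_free: "lin_comb ?m x \<in> free_space (PiE J W)"
    unfolding lin_comb_def
    by (intro fun_vs.subspace_sum[OF subspace_free_space] fun_vs.subspace_scale[OF subspace_free_space] m_free)
      (use supp in blast)
  have "tensor_rel J W `` {lin_comb ?m x} = tensor_rel J W `` {?m f}"
  proof -
    have eq: "?m f - y = (?m f - lin_comb ?m x) + (lin_comb ?m x - y)" for y by simp
    have eq': "lin_comb ?m x - y = (?m f - y) - (?m f - lin_comb ?m x)" for y by simp
    have "lin_comb ?m x - y \<in> tensor_relations J W \<longleftrightarrow> ?m f - y \<in> tensor_relations J W" for y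
      using R'' unfolding tensor_relations_def
      by (metis (no_types, lifting) eq eq' fun_vs.span_add fun_vs.span_diff)
    then show ?thesis
      using x_free m_free[OF f] by (auto simp: tensor_rel_def)
  qed
  then show ?thesis
    by (simp add: tensor_map_def tensor_lift_def pure_tensor_def flip: x_def)
      (simp add: x_def pure_tensor_def)
qed

lemma functional_basis_vec:
  fixes g :: "'a \<Rightarrow> 'b::field"
  shows "b \<in> B \<Longrightarrow> functional B g (basis_vec b) = g b"
proof -
  assume b: "b \<in> B"
  have "{b'. basis_vec b b' \<noteq> (0::'b)} = {b}" by (auto simp: basis_vec_def)
  moreover have "(basis_vec b :: 'a \<Rightarrow> 'b) \<in> free_space B"
    using b finite_supp_basis_vec[of b] by (auto simp: free_space_def basis_vec_def)
  moreover have "basis_vec b b = (1::'b)" by (simp add: basis_vec_def)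
  ultimately show ?thesis by (simp add: functional_def)
qed

lemma functional_add:
  "functional B (\<lambda>b. g b + h b) = functional B g + functional B h"
  by (auto simp: functional_def fun_eq_iff algebra_simps sum.distrib)

lemma functional_scale: "functional B (\<lambda>b. c * g b) = fscale c (functional B g)"
  by (auto simp: functional_def fscale_def fun_eq_iff sum_distrib_left algebra_simps)

lemma ext_prod_pure:
  assumes P: "finite P" and f: "f \<in> PiE P V" and X: "X \<in> faces_on I Q"
  shows "ext_prod I P Q (pure_tensor P V f) (basis_vec X)
       = (\<Prod>B\<in>P. f B (basis_vec (face_restrict I Q X B)))"
proof -
  have upd: "(\<Prod>B\<in>P. (f(j := u)) B (g B)) = u (g j) * (\<Prod>B\<in>P - {j}. f B (g B))"
    if "j \<in> P" for f :: "'a set \<Rightarrow> ('a face \<Rightarrow> 'b) \<Rightarrow> 'b" and j u g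
    using P that by (subst prod.remove[of P j]) auto
  have "multilinear_on P V (prod_on_pure I P Q)"
    unfolding multilinear_on_def prod_on_pure_def
    by (simp add: upd distrib_right mult.assoc
        functional_add[symmetric] functional_scale[symmetric] del: fun_upd_apply)
      (simp add: upd fscale_def mult.assoc del: fun_upd_apply)
  then have "ext_prod I P Q (pure_tensor P V f) = prod_on_pure I P Q f"
    unfolding ext_prod_def by (rule tensor_lift_pure) fact
  then show ?thesis by (simp add: prod_on_pure_def functional_basis_vec X)
qed

end

(* Faces of the arrangement with support T[Q] are the sign classes of the points h for which
   exactly the sums over unions of blocks of Q vanish. On such points restriction to a block sets
   the other coordinates to zero, and X^[C,D] is the face of h + e (1_c - 1_d) with c in C, d in D
   and e > 0 small. Hence a cut inside the block S of P only changes the restriction to S, where it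
   is again a cut, and the derivative along the cut differentiates exactly the S-factor of a
   product. Iterating along the nodes in their layering gives the formula on pure tensors, and
   linearity the general case. *)

theory Submission
  imports Defs
begin

section \<open>Points and faces of the arrangement\<close>

text \<open>Restricted and cut faces are definite descriptions of a face with prescribed signs, and
  a sign vector need not come from any point; nothing is known about such a description until a face
  is exhibited. Points remove this obstacle: a generic point produces the face, its subset sums are
  compared with the prescription, and the signs determine the face. The tilt uses single elements
  \<open>c\<close> and \<open>d\<close> because a union of blocks of the cut partition contains
  \<open>C\<close> iff it contains \<open>c\<close>. Its size \<open>e\<close> lies below the
  absolute value of every nonzero subset sum. Truncation to a block only yields sums that already
  occur for the original point, so the same \<open>c\<close>, \<open>d\<close> and \<open>e\<close>
  serve before and after restriction, and the two constructions are compared on points.\<close>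

definition sign_face :: "'a set \<Rightarrow> ('a \<Rightarrow> real) \<Rightarrow> 'a face"
  where "sign_face I h =
    {h' \<in> T_dual I {I}. \<forall>S. S \<noteq> {} \<and> S \<subset> I \<longrightarrow> sgn (sum h' S) = sgn (sum h S)}"

text \<open>For \<open>S\<close> inside \<open>I\<close> these are the sets reducing to the empty
  set mod \<open>Q\<close> (\<open>redn_empty_iff\<close>). Testing block by block keeps
  intersections and cuts easy to follow.\<close>

definition saturated :: "'a set set \<Rightarrow> 'a set \<Rightarrow> bool"
  where "saturated Q S \<longleftrightarrow> (\<forall>B\<in>Q. B \<subseteq> S \<or> B \<inter> S = {})"

definition generic_point :: "'a set \<Rightarrow> 'a set set \<Rightarrow> ('a \<Rightarrow> real) \<Rightarrow> bool"
  where "generic_point I Q h \<longleftrightarrow> h \<in> T_dual I {I} \<and>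
    (\<forall>S. S \<noteq> {} \<and> S \<subset> I \<longrightarrow> (sum h S = 0 \<longleftrightarrow> saturated Q S))"

definition tilt :: "('a \<Rightarrow> real) \<Rightarrow> real \<Rightarrow> 'a \<Rightarrow> 'a \<Rightarrow> 'a \<Rightarrow> real"
  where "tilt h e c d = (\<lambda>i. h i + (if i = c then e else 0) - (if i = d then e else 0))"

definition zero_outside :: "'a set \<Rightarrow> ('a \<Rightarrow> real) \<Rightarrow> 'a \<Rightarrow> real"
  where "zero_outside B h = (\<lambda>i. if i \<in> B then h i else 0)"

lemma sum_tilt:
  "finite S \<Longrightarrow> sum (tilt h e c d) S
     = sum h S + (if c \<in> S then e else 0) - (if d \<in> S then e else 0)"
  by (simp add: tilt_def sum.distrib sum_subtractf)

lemma sum_zero_outside: "finite S \<Longrightarrow> sum (zero_outside B h) S = sum h (S \<inter> B)"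
  by (simp add: zero_outside_def sum.inter_restrict)

lemma mem_sign_face: "h \<in> T_dual I {I} \<Longrightarrow> h \<in> sign_face I h"
  by (simp add: sign_face_def)

text \<open>All points of a face share their signs, so the point picked by choice in
  \<open>face_sign\<close> may be exchanged for \<open>h\<close>.\<close>

lemma face_sign_sign_face:
  assumes "h \<in> T_dual I {I}" "S \<noteq> {}" "S \<subset> I"
  shows "face_sign (sign_face I h) S = sgn (sum h S)"
proof -
  have "(SOME h'. h' \<in> sign_face I h) \<in> sign_face I h"
    using mem_sign_face[OF assms(1)] by (rule someI[of "\<lambda>h'. h' \<in> sign_face I h"])
  then show ?thesis using assms unfolding face_sign_def by (simp add: sign_face_def)
qed

lemma adjoint_facesE:
  assumes "X \<in> adjoint_faces I"
  obtains h where "h \<in> T_dual I {I}" "X = sign_face I h"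
  using assms unfolding adjoint_faces_def sign_face_def by blast

text \<open>A face is the class of all points with given signs. This is the uniqueness half of the
  definite descriptions of restricted and cut faces.\<close>

lemma adjoint_face_eqI:
  assumes "X \<in> adjoint_faces I" "Y \<in> adjoint_faces I"
    and "\<And>S. S \<noteq> {} \<Longrightarrow> S \<subset> I \<Longrightarrow> face_sign X S = face_sign Y S"
  shows "X = Y"
proof -
  obtain g h where g: "g \<in> T_dual I {I}" "X = sign_face I g"
    and h: "h \<in> T_dual I {I}" "Y = sign_face I h"
    using assms(1,2) adjoint_facesE by metis
  have "sgn (sum g S) = sgn (sum h S)" if "S \<noteq> {}" "S \<subset> I" for S
    using assms(3)[OF that] face_sign_sign_face[OF g(1) that] face_sign_sign_face[OF h(1) that]
    by (simp add: g h)
  then show ?thesis by (auto simp: g h sign_face_def)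
qed

section \<open>Saturated sets and the supports of faces\<close>

lemma subspace_T_dual: "fun_vs.subspace (T_dual I P)"
  unfolding fun_vs.subspace_def T_dual_def
  by (auto simp: fscale_def sum.distrib sum_distrib_left[symmetric])

lemma partition_on_block_unique:
  "partition_on I Q \<Longrightarrow> B \<in> Q \<Longrightarrow> B' \<in> Q \<Longrightarrow> x \<in> B \<Longrightarrow> x \<in> B' \<Longrightarrow> B = B'"
  unfolding partition_on_def disjoint_def by blast

text \<open>\<open>redn\<close> deletes exactly the points covered by blocks inside
  \<open>S\<close>. If nothing is left, a block meeting \<open>S\<close> shares a point with one of
  those blocks and therefore equals it.\<close>

lemma redn_empty_iff:
  assumes "partition_on I Q" "S \<subseteq> I"
  shows "redn Q S = {} \<longleftrightarrow> saturated Q S"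
proof
  assume *: "redn Q S = {}"
  show "saturated Q S" unfolding saturated_def
  proof (intro ballI)
    fix B assume B: "B \<in> Q"
    have "B \<subseteq> S" if "x \<in> B" "x \<in> S" for x
    proof -
      obtain B' where "B' \<in> Q" "B' \<subseteq> S" "x \<in> B'" using * \<open>x \<in> S\<close> unfolding redn_def by blast
      then show ?thesis using partition_on_block_unique[OF assms(1) B] that by blast
    qed
    then show "B \<subseteq> S \<or> B \<inter> S = {}" by blast
  qed
next
  assume "saturated Q S"
  then show "redn Q S = {}"
    using assms unfolding redn_def saturated_def partition_on_def by blast
qed

lemma sum_saturated:
  assumes "finite I" "partition_on I Q" "h \<in> T_dual I Q" "S \<subseteq> I" "saturated Q S"
  shows "sum h S = 0"
proof -
  have "\<Union>{B \<in> Q. B \<subseteq> S} = S"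
    using redn_empty_iff[OF assms(2,4)] assms(5) by (auto simp: redn_def)
  moreover have "sum h (\<Union>{B \<in> Q. B \<subseteq> S}) = (\<Sum>B\<in>{B \<in> Q. B \<subseteq> S}. sum h B)"
    using partition_on_block_unique[OF assms(2)] finite_subset[OF _ finite_subset[OF assms(4,1)]]
    by (intro sum.Union_disjoint[unfolded comp_def]) auto
  moreover have "\<dots> = 0" using assms(3) by (intro sum.neutral) (auto simp: T_dual_def)
  ultimately show ?thesis by simp
qed

lemma T_dual_refine:
  assumes "finite I" "partition_on I Q"
  shows "T_dual I Q \<subseteq> T_dual I {I}"
proof
  fix h assume h: "h \<in> T_dual I Q"
  have "saturated Q I" using assms(2) by (auto simp: saturated_def partition_on_def)
  then show "h \<in> T_dual I {I}"
    using sum_saturated[OF assms h, of I] h by (auto simp: T_dual_def)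
qed

text \<open>Each of the finitely many inequalities holds for all small \<open>e\<close>, by
  continuity at 0. With \<open>g\<close> a direction in the support it keeps a point in its face;
  with the constant 1 it bounds the tilt in \<open>cut_facesE\<close>.\<close>

lemma ex_small_perturbation:
  fixes g h :: "'a \<Rightarrow> real"
  assumes "finite I"
  obtains e where "e > 0" "\<And>S. S \<subseteq> I \<Longrightarrow> sum h S \<noteq> 0 \<Longrightarrow> e * \<bar>sum g S\<bar> < \<bar>sum h S\<bar>"
proof -
  have "\<forall>\<^sub>F e in at_right 0. e * \<bar>sum g S\<bar> < \<bar>sum h S\<bar>" if "sum h S \<noteq> 0" for S
  proof -
    have "((\<lambda>e. e * \<bar>sum g S\<bar>) \<longlongrightarrow> 0 * \<bar>sum g S\<bar>) (at_right 0)"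
      by (intro tendsto_intros)
    then show ?thesis using that by (intro order_tendstoD) auto
  qed
  then have "\<forall>\<^sub>F e in at_right 0. \<forall>S\<in>{S \<in> Pow I. sum h S \<noteq> 0}. e * \<bar>sum g S\<bar> < \<bar>sum h S\<bar>"
    using assms by (intro eventually_ball_finite) auto
  then have "\<forall>\<^sub>F e in at_right 0. e > (0::real) \<and>
      (\<forall>S\<in>{S \<in> Pow I. sum h S \<noteq> 0}. e * \<bar>sum g S\<bar> < \<bar>sum h S\<bar>)"
    by (intro eventually_conj eventually_at_right_less)
  then obtain e where "e > 0 \<and> (\<forall>S\<in>{S \<in> Pow I. sum h S \<noteq> 0}. e * \<bar>sum g S\<bar> < \<bar>sum h S\<bar>)"
    using eventually_happens trivial_limit_at_right_real by blast
  then show thesis using that by blast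
qed

lemma sgn_add_small: "\<bar>y\<bar> < \<bar>x\<bar> \<Longrightarrow> sgn (x + y) = sgn (x::real)"
  by (auto simp: sgn_if split: if_splits)

text \<open>Sums over blocks vanish on the face, and within \<open>T_dual I Q\<close> the face is
  open: \<open>h + fscale e g\<close> stays in it for small \<open>e\<close>, so each direction
  \<open>g\<close> is a multiple of a difference of two of its points.\<close>

lemma span_generic_face:
  assumes fin: "finite I" and Q: "partition_on I Q" and h: "generic_point I Q h"
  shows "fun_vs.span (sign_face I h) = T_dual I Q"
proof
  have hI: "h \<in> T_dual I {I}" using h by (simp add: generic_point_def)
  have sub: "sign_face I h \<subseteq> T_dual I Q"
  proof
    fix g assume g: "g \<in> sign_face I h"
    have "sum g B = 0" if B: "B \<in> Q" for B
    \<comment> \<open>The set \<open>I\<close> itself indexes no hyperplane; its sum vanishes by the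
      definition of the ambient space.\<close>
    proof (cases "B = I")
      case True
      then show ?thesis using g by (auto simp: sign_face_def T_dual_def)
    next
      case False
      then have "B \<noteq> {}" "B \<subset> I" using B Q by (auto simp: partition_on_def)
      moreover have "saturated Q B"
        using partition_on_block_unique[OF Q B] unfolding saturated_def by blast
      ultimately have "sgn (sum g B) = sgn (0::real)"
        using g h by (auto simp: sign_face_def generic_point_def)
      then show ?thesis by (simp add: sgn_zero_iff)
    qed
    then show "g \<in> T_dual I Q" using g by (auto simp: sign_face_def T_dual_def)
  qed
  show "fun_vs.span (sign_face I h) \<subseteq> T_dual I Q"
    using sub subspace_T_dual by (rule fun_vs.span_minimal)
  show "T_dual I Q \<subseteq> fun_vs.span (sign_face I h)"
  proof
    fix g assume g: "g \<in> T_dual I Q"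
    obtain e where e: "e > 0" "\<And>S. S \<subseteq> I \<Longrightarrow> sum h S \<noteq> 0 \<Longrightarrow> e * \<bar>sum g S\<bar> < \<bar>sum h S\<bar>"
      using ex_small_perturbation[OF fin] by metis
    have sums: "sum (h + fscale e g) S = sum h S + e * sum g S" for S
      by (simp add: fscale_def sum.distrib sum_distrib_left)
    have "h + fscale e g \<in> sign_face I h"
      unfolding sign_face_def
    proof (intro CollectI conjI allI impI)
      show "h + fscale e g \<in> T_dual I {I}"
        using hI g T_dual_refine[OF fin Q] subspace_T_dual[of I "{I}"]
        by (auto intro!: fun_vs.subspace_add fun_vs.subspace_scale)
      fix S assume S: "S \<noteq> {} \<and> S \<subset> I"
      show "sgn (sum (h + fscale e g) S) = sgn (sum h S)"
      proof (cases "sum h S = 0")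
        case True
        then have "sum g S = 0"
          using sum_saturated[OF fin Q g, of S] S h by (auto simp: generic_point_def)
        then show ?thesis by (simp add: sums True del: plus_fun_apply)
      next
        case False
        then show ?thesis unfolding sums
          using e S by (intro sgn_add_small) (auto simp: abs_mult)
      qed
    qed
    then have "fscale (1 / e) ((h + fscale e g) - h) \<in> fun_vs.span (sign_face I h)"
      by (intro fun_vs.span_scale fun_vs.span_diff fun_vs.span_base mem_sign_face hI)
    also have "fscale (1 / e) ((h + fscale e g) - h) = g"
      using e by (auto simp: fscale_def fun_eq_iff)
    finally show "g \<in> fun_vs.span (sign_face I h)" .
  qed
qed

text \<open>A sum over \<open>S\<close> that vanishes at \<open>h\<close> vanishes on the face and
  on its span. If \<open>S\<close> split a block, containing \<open>x\<close> but not
  \<open>y\<close>, then \<open>tilt 0 1 x y\<close>, the difference of the two unit vectors, would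
  lie in \<open>T_dual I Q\<close> and have sum 1 over \<open>S\<close>.\<close>

lemma generic_point_of_span:
  assumes fin: "finite I" and Q: "partition_on I Q" and h: "h \<in> T_dual I {I}"
    and span: "fun_vs.span (sign_face I h) = T_dual I Q"
  shows "generic_point I Q h"
  unfolding generic_point_def
proof (intro conjI allI impI)
  fix S assume S: "S \<noteq> {} \<and> S \<subset> I"
  have hQ: "h \<in> T_dual I Q" using mem_sign_face[OF h] span fun_vs.span_base by blast
  show "sum h S = 0 \<longleftrightarrow> saturated Q S"
  proof
    assume 0: "sum h S = 0"
    have "fun_vs.subspace {g. sum g S = (0::real)}"
      by (auto simp: fun_vs.subspace_def fscale_def sum.distrib sum_distrib_left[symmetric])
    moreover have "sign_face I h \<subseteq> {g. sum g S = 0}"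
      using S 0 by (auto simp: sign_face_def sgn_zero_iff)
    ultimately have T: "T_dual I Q \<subseteq> {g. sum g S = 0}"
      unfolding span[symmetric] by (intro fun_vs.span_minimal)
    show "saturated Q S"
    proof (rule ccontr)
      assume "\<not> saturated Q S"
      then obtain B x y where B: "B \<in> Q" "x \<in> B" "x \<in> S" "y \<in> B" "y \<notin> S"
        by (auto simp: saturated_def)
      have fB: "finite B'" if "B' \<in> Q" for B'
        using that Q fin by (auto simp: partition_on_def intro: finite_subset)
      have "x \<in> B' \<longleftrightarrow> y \<in> B'" if "B' \<in> Q" for B'
        using partition_on_block_unique[OF Q B(1) that] B by blast
      moreover have "x \<in> I" "y \<in> I" using B Q by (auto simp: partition_on_def)
      ultimately have "tilt 0 1 x y \<in> T_dual I Q"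
        by (auto simp: T_dual_def sum_tilt fB) (auto simp: tilt_def)
      then have "sum (tilt 0 1 x y) S = 0" using T by blast
      moreover have "finite S" using S fin by (auto intro: finite_subset)
      ultimately show False using B by (simp add: sum_tilt)
    qed
  qed (use sum_saturated[OF fin Q hQ, of S] S in auto)
qed (fact h)

lemma faces_on_eq:
  assumes "finite I" "partition_on I Q"
  shows "faces_on I Q = sign_face I ` {h. generic_point I Q h}"
proof (intro equalityI subsetI)
  fix X assume "X \<in> faces_on I Q"
  then have X: "X \<in> adjoint_faces I" "fun_vs.span X = T_dual I Q"
    by (auto simp: faces_on_def)
  from X(1) obtain h where "h \<in> T_dual I {I}" "X = sign_face I h" by (rule adjoint_facesE)
  then show "X \<in> sign_face I ` {h. generic_point I Q h}"
    using generic_point_of_span[OF assms] X(2) by blast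
next
  fix X assume "X \<in> sign_face I ` {h. generic_point I Q h}"
  then show "X \<in> faces_on I Q"
    using span_generic_face[OF assms]
    by (auto simp: faces_on_def adjoint_faces_def sign_face_def generic_point_def)
qed

lemma generic_point_T_dual: "generic_point I Q h \<Longrightarrow> h \<in> T_dual I {I}"
  by (simp add: generic_point_def)

section \<open>Restricting and cutting faces\<close>

lemma partition_on_partition_at:
  assumes "partition_on I Q" "B \<subseteq> I" "saturated Q B"
  shows "partition_on I (partition_at I Q B)"
proof -
  have "B = \<Union>{B' \<in> Q. B' \<subseteq> B}"
    using redn_empty_iff[OF assms(1,2)] assms(3) by (auto simp: redn_def)
  then have "\<Union>(partition_at I Q B) = I" using assms(2) by (auto simp: partition_at_def)
  moreover have "disjoint (partition_at I Q B)"
    using assms(1) unfolding disjoint_def partition_at_def partition_on_def by fast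
  moreover have "{} \<notin> partition_at I Q B"
    using assms(1) by (auto simp: partition_at_def partition_on_def)
  ultimately show ?thesis by (simp add: partition_on_def)
qed

text \<open>The added singletons impose no condition, and a block of \<open>Q\<close> not inside
  \<open>B\<close> misses \<open>B\<close>, hence also \<open>S \<inter> B\<close>.\<close>

lemma saturated_partition_at:
  assumes "saturated Q B"
  shows "saturated (partition_at I Q B) S \<longleftrightarrow> saturated Q (S \<inter> B)"
proof -
  have "saturated (partition_at I Q B) S \<longleftrightarrow> (\<forall>B'\<in>Q. B' \<subseteq> B \<longrightarrow> B' \<subseteq> S \<or> B' \<inter> S = {})"
    unfolding saturated_def partition_at_def by blast
  also have "\<dots> \<longleftrightarrow> saturated Q (S \<inter> B)"
    using assms unfolding saturated_def by blast
  finally show ?thesis .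
qed

lemma generic_point_zero_outside:
  assumes fin: "finite I" and Q: "partition_on I Q" and B: "B \<subseteq> I" "saturated Q B"
    and h: "generic_point I Q h"
  shows "generic_point I (partition_at I Q B) (zero_outside B h)"
  unfolding generic_point_def
proof (intro conjI allI impI)
  have hI: "h \<in> T_dual I {I}" using h by (simp add: generic_point_def)
  have "sum h B = 0"
  \<comment> \<open>Genericity speaks of nonempty proper subsets only, so the two extreme values of
    \<open>B\<close> are settled separately.\<close>
  proof (cases "B = {} \<or> B = I")
    case True
    then show ?thesis using hI by (auto simp: T_dual_def)
  next
    case False
    then show ?thesis using h B by (auto simp: generic_point_def)
  qed
  then show "zero_outside B h \<in> T_dual I {I}"
    using B fin by (auto simp: T_dual_def sum_zero_outside Int_absorb1)
      (auto simp: zero_outside_def)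
  fix S assume S: "S \<noteq> {} \<and> S \<subset> I"
  then have fS: "finite S" using fin by (auto intro: finite_subset)
  show "sum (zero_outside B h) S = 0 \<longleftrightarrow> saturated (partition_at I Q B) S"
  proof (cases "S \<inter> B = {}")
    case True
    then show ?thesis
      unfolding saturated_partition_at[OF B(2)] sum_zero_outside[OF fS] by (simp add: saturated_def)
  next
    case False
    moreover have "S \<inter> B \<subset> I" using S by blast
    ultimately show ?thesis
      unfolding saturated_partition_at[OF B(2)] sum_zero_outside[OF fS]
      using h by (simp add: generic_point_def)
  qed
qed

text \<open>The truncated point supplies the face that the definite description presupposes: summing
  it over \<open>S\<close> is summing \<open>h\<close> over \<open>S \<inter> B\<close>, with 0 for
  an empty intersection.\<close>

lemma face_restrict_sign_face:
  assumes fin: "finite I" and Q: "partition_on I Q" and B: "B \<subseteq> I" "saturated Q B"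
    and h: "generic_point I Q h"
  shows "face_restrict I Q (sign_face I h) B = sign_face I (zero_outside B h)"
    and "sign_face I (zero_outside B h) \<in> faces_on I (partition_at I Q B)"
proof -
  note g = generic_point_zero_outside[OF assms]
  note gI = generic_point_T_dual[OF g] and hI = generic_point_T_dual[OF h]
  show mem: "sign_face I (zero_outside B h) \<in> faces_on I (partition_at I Q B)"
    unfolding faces_on_eq[OF fin partition_on_partition_at[OF Q B]] using g by blast
  have sgn: "face_sign (sign_face I (zero_outside B h)) S
      = (if S \<inter> B \<noteq> {} then face_sign (sign_face I h) (S \<inter> B) else 0)"
    if S: "S \<noteq> {} \<and> S \<subset> I" for S
  proof -
    have "finite S" using S fin by (auto intro: finite_subset)
    moreover have "S \<inter> B \<subset> I" using S by blast
    ultimately show ?thesis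
      using S by (auto simp: face_sign_sign_face[OF gI] face_sign_sign_face[OF hI] sum_zero_outside)
  qed
  show "face_restrict I Q (sign_face I h) B = sign_face I (zero_outside B h)"
    unfolding face_restrict_def
  proof (rule the_equality)
    fix Y assume Y: "Y \<in> faces_on I (partition_at I Q B) \<and>
      (\<forall>S. S \<noteq> {} \<and> S \<subset> I \<longrightarrow>
        face_sign Y S = (if S \<inter> B \<noteq> {} then face_sign (sign_face I h) (S \<inter> B) else 0))"
    show "Y = sign_face I (zero_outside B h)"
      by (rule adjoint_face_eqI[of _ I]) (use Y mem sgn in \<open>auto simp: faces_on_def\<close>)
  qed (use mem sgn in blast)
qed

section \<open>Cuts of a partition and the faces they produce\<close>

definition valid_cut :: "'a set set \<Rightarrow> 'a set \<times> 'a set \<Rightarrow> bool"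
  where "valid_cut Q V \<longleftrightarrow> (case V of (C, D) \<Rightarrow>
    C \<union> D \<in> Q \<and> C \<inter> D = {} \<and> C \<noteq> {} \<and> D \<noteq> {})"

lemma valid_cut_swap: "valid_cut Q (C, D) \<Longrightarrow> valid_cut Q (D, C)"
  by (auto simp: valid_cut_def Un_commute)

lemma cut_target_swap: "cut_target Q (D, C) = cut_target Q (C, D)"
  by (auto simp: cut_target_def Un_commute)

lemma partition_on_cut_target:
  assumes Q: "partition_on I Q" and V: "valid_cut Q (C, D)"
  shows "partition_on I (cut_target Q (C, D))"
proof (rule partition_onI)
  show "\<Union>(cut_target Q (C, D)) = I"
    using Q V by (auto simp: partition_on_def cut_target_def valid_cut_def)
  show "{} \<notin> cut_target Q (C, D)"
    using Q V by (auto simp: partition_on_def cut_target_def valid_cut_def)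
next
  fix p q assume *: "p \<in> cut_target Q (C, D)" "q \<in> cut_target Q (C, D)" "p \<noteq> q"
  have "B \<inter> (C \<union> D) = {}" if "B \<in> Q" "B \<noteq> C \<union> D" for B
    using that V partition_on_block_unique[OF Q, of B "C \<union> D"] by (auto simp: valid_cut_def)
  moreover have "B \<inter> B' = {}" if "B \<in> Q" "B' \<in> Q" "B \<noteq> B'" for B B'
    using that partition_on_block_unique[OF Q, of B B'] by blast
  ultimately show "disjnt p q"
    using * V unfolding disjnt_def cut_target_def valid_cut_def by auto
qed

text \<open>A proper part \<open>C\<close> of a block contains no block, so it is its own reduction.
  Hence \<open>S\<close> agrees with \<open>C\<close> mod \<open>Q\<close> exactly when
  \<open>S\<close> is \<open>C\<close> together with whole blocks other than
  \<open>C \<union> D\<close>.\<close>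

lemma eq_mod_left_iff:
  assumes Q: "partition_on I Q" and V: "valid_cut Q (C, D)" and S: "S \<subseteq> I"
  shows "eq_mod Q S C \<longleftrightarrow> saturated (cut_target Q (C, D)) S \<and> C \<subseteq> S \<and> D \<inter> S = {}"
proof -
  have C: "redn Q C = C"
  proof -
    have "\<not> B \<subseteq> C" if B: "B \<in> Q" for B
    proof
      assume "B \<subseteq> C"
      moreover obtain x where "x \<in> B" using Q B unfolding partition_on_def by (metis all_not_in_conv)
      ultimately have "B = C \<union> D"
        using V B partition_on_block_unique[OF Q, of B "C \<union> D" x] by (auto simp: valid_cut_def)
      then show False using \<open>B \<subseteq> C\<close> V by (auto simp: valid_cut_def)
    qed
    then show ?thesis by (auto simp: redn_def)
  qed
  show ?thesis unfolding eq_mod_def C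
  proof
    assume R: "redn Q S = C"
    then have CS: "C \<subseteq> S" by (auto simp: redn_def)
    have nCD: "\<not> C \<union> D \<subseteq> S"
    proof
      assume "C \<union> D \<subseteq> S"
      then have "redn Q S \<inter> C = {}" using V by (auto simp: redn_def valid_cut_def)
      then show False using R V by (auto simp: valid_cut_def)
    qed
    \<comment> \<open>A point of \<open>S\<close> outside \<open>C\<close> was deleted by
      \<open>redn\<close>, hence sits in a block inside \<open>S\<close>.\<close>
    have cov: "B \<subseteq> S" if x: "B \<in> Q" "x \<in> B" "x \<in> S" "x \<notin> C" for B x
    proof -
      obtain B' where "B' \<in> Q" "B' \<subseteq> S" "x \<in> B'" using R x unfolding redn_def by blast
      then show ?thesis using partition_on_block_unique[OF Q x(1)] x by blast
    qed
    have DS: "D \<inter> S = {}"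
      using cov[of "C \<union> D"] nCD V by (auto simp: valid_cut_def)
    have "B \<subseteq> S \<or> B \<inter> S = {}" if "B \<in> Q" "B \<noteq> C \<union> D" for B
      using cov[OF that(1)] partition_on_block_unique[OF Q that(1), of "C \<union> D"] that(2) V
      by (auto simp: valid_cut_def)
    then show "saturated (cut_target Q (C, D)) S \<and> C \<subseteq> S \<and> D \<inter> S = {}"
      using CS DS by (auto simp: saturated_def cut_target_def)
  next
    assume *: "saturated (cut_target Q (C, D)) S \<and> C \<subseteq> S \<and> D \<inter> S = {}"
    show "redn Q S = C"
    proof (intro equalityI subsetI)
      fix x assume x: "x \<in> redn Q S"
      then obtain B where B: "B \<in> Q" "x \<in> B" "x \<in> S" "\<not> B \<subseteq> S"
        using S Q unfolding redn_def partition_on_def by blast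
      then have "B = C \<union> D" using * unfolding saturated_def cut_target_def by blast
      then show "x \<in> C" using B * by blast
    next
      fix x assume x: "x \<in> C"
      have "B = C \<union> D" if "B \<in> Q" "x \<in> B" for B
        using that x V partition_on_block_unique[OF Q that(1), of "C \<union> D" x]
        by (auto simp: valid_cut_def)
      then have "\<not> B \<subseteq> S" if "B \<in> Q" "x \<in> B" for B
        using that * V by (fastforce simp: valid_cut_def)
      then show "x \<in> redn Q S" using x * by (auto simp: redn_def)
    qed
  qed
qed

text \<open>Moving a generic point of a face slightly towards the half-space where \<open>C\<close> is positive
  keeps the nonzero signs and turns the zero signs into those prescribed for the cut face.\<close>

lemma cut_face_sign_face:
  assumes fin: "finite I" and Q: "partition_on I Q" and V: "valid_cut Q (C, D)"
    and h: "generic_point I (cut_target Q (C, D)) h" and cd: "c \<in> C" "d \<in> D"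
    and e: "e > 0" "\<forall>S. S \<subset> I \<longrightarrow> sum h S \<noteq> 0 \<longrightarrow> e < \<bar>sum h S\<bar>"
  shows "cut_face I Q (C, D) (sign_face I h) = sign_face I (tilt h e c d)"
    and "generic_point I Q (tilt h e c d)"
proof -
  let ?Q = "cut_target Q (C, D)" and ?g = "tilt h e c d"
  have Q': "partition_on I ?Q" using partition_on_cut_target Q V by blast
  have CDI: "C \<union> D \<subseteq> I" using Q V by (auto simp: partition_on_def valid_cut_def)
  have hI: "h \<in> T_dual I {I}" using h by (simp add: generic_point_def)
  have "c \<in> I" "d \<in> I" using CDI cd by auto
  then have gI: "?g \<in> T_dual I {I}"
    using hI fin by (auto simp: T_dual_def sum_tilt) (auto simp: tilt_def)
  have fS: "finite S" if "S \<subset> I" for S using that fin by (auto intro: finite_subset)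
  \<comment> \<open>Here the sum is nonzero, and the tilt changes it by \<open>e\<close>,
    \<open>- e\<close> or 0, less than its absolute value.\<close>
  have unsat: "sgn (sum ?g S) = sgn (sum h S)" "sum h S \<noteq> 0" "\<not> saturated Q S"
    if S: "S \<noteq> {}" "S \<subset> I" "\<not> saturated ?Q S" for S
  proof -
    show 1: "sum h S \<noteq> 0" using h S by (simp add: generic_point_def)
    have "sum ?g S = sum h S + ((if c \<in> S then e else 0) - (if d \<in> S then e else 0))"
      using fS[OF S(2)] by (simp add: sum_tilt)
    then show "sgn (sum ?g S) = sgn (sum h S)"
      using e(2)[rule_format, OF S(2) 1] e(1) by (simp only:) (intro sgn_add_small, auto)
    show "\<not> saturated Q S"
      using S(3) V unfolding saturated_def cut_target_def valid_cut_def by fast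
  qed
  \<comment> \<open>The sum of \<open>h\<close> vanishes here, so the sign is decided by
    \<open>c\<close> and \<open>d\<close> alone.\<close>
  have sat: "sum ?g S = (if c \<in> S then e else 0) - (if d \<in> S then e else 0)"
    if S: "S \<noteq> {}" "S \<subset> I" "saturated ?Q S" for S
    using S h fS[OF S(2)] by (simp add: sum_tilt generic_point_def)
  have satC: "c \<in> S \<longleftrightarrow> C \<subseteq> S" "c \<in> S \<longleftrightarrow> C \<inter> S \<noteq> {}" "d \<in> S \<longleftrightarrow> D \<subseteq> S" "d \<in> S \<longleftrightarrow> D \<inter> S \<noteq> {}"
    if S: "saturated ?Q S" for S
    using S cd unfolding saturated_def cut_target_def by blast+
  \<comment> \<open>A union of blocks of the cut partition is a union of blocks of \<open>Q\<close>
    iff it does not separate \<open>C\<close> from \<open>D\<close>.\<close>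
  have satP: "saturated Q S \<longleftrightarrow> (c \<in> S \<longleftrightarrow> d \<in> S)" if S: "saturated ?Q S" for S
  proof
    assume "saturated Q S"
    then have "C \<union> D \<subseteq> S \<or> (C \<union> D) \<inter> S = {}"
      using V unfolding saturated_def valid_cut_def by fast
    then show "c \<in> S \<longleftrightarrow> d \<in> S" using cd by blast
  next
    assume "c \<in> S \<longleftrightarrow> d \<in> S"
    then have "C \<union> D \<subseteq> S \<or> (C \<union> D) \<inter> S = {}" using satC[OF S] by blast
    then show "saturated Q S" using S unfolding saturated_def cut_target_def by auto
  qed
  show g: "generic_point I Q ?g"
    unfolding generic_point_def
  proof (intro conjI allI impI gI)
    fix S assume S: "S \<noteq> {} \<and> S \<subset> I"
    show "sum ?g S = 0 \<longleftrightarrow> saturated Q S"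
    proof (cases "saturated ?Q S")
      case True
      then show ?thesis using sat[of S] satP[OF True] S e(1) by auto
    next
      case False
      then show ?thesis using unsat[of S] S by (metis sgn_zero_iff)
    qed
  qed
  then have mem: "sign_face I ?g \<in> faces_on I Q"
    unfolding faces_on_eq[OF fin Q] by blast
  have left: "eq_mod Q S C \<longleftrightarrow> saturated ?Q S \<and> c \<in> S \<and> d \<notin> S" if "S \<subset> I" for S
    using eq_mod_left_iff[OF Q V, of S] that satC[of S] by blast
  have right: "eq_mod Q S D \<longleftrightarrow> saturated ?Q S \<and> d \<in> S \<and> c \<notin> S" if "S \<subset> I" for S
    using eq_mod_left_iff[OF Q valid_cut_swap[OF V], of S] that satC[of S]
    unfolding cut_target_swap[of Q D C] by blast
  have zero: "eq_mod Q' S {} \<longleftrightarrow> saturated Q' S" if "S \<subset> I" "partition_on I Q'" for S Q'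
    using redn_empty_iff[of I Q' S] that by (auto simp: eq_mod_def redn_def)
  let ?spec = "\<lambda>Y S. (eq_mod Q S C \<longrightarrow> face_sign Y S = 1)
      \<and> (eq_mod Q S D \<longrightarrow> face_sign Y S = - 1)
      \<and> (\<not> eq_mod ?Q S {} \<longrightarrow> face_sign Y S = face_sign (sign_face I h) S)
      \<and> (eq_mod Q S {} \<longrightarrow> face_sign Y S = 0)"
  have spec: "?spec (sign_face I ?g) S" if S: "S \<noteq> {}" "S \<subset> I" for S
    unfolding left[OF S(2)] right[OF S(2)] zero[OF S(2) Q] zero[OF S(2) Q']
      face_sign_sign_face[OF gI S] face_sign_sign_face[OF hI S]
    using sat[OF S] unsat[OF S] satP[of S] e(1) by (cases "saturated ?Q S") auto
  \<comment> \<open>The four clauses cover every \<open>S\<close>: not a union of cut blocks, or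
    such a union with \<open>C\<close> alone, with \<open>D\<close> alone, or with both or neither.
    So no sign is left open.\<close>
  have determined: "face_sign Y S = face_sign Z S"
    if S: "S \<noteq> {}" "S \<subset> I" and "?spec Y S" "?spec Z S" for Y Z S
    using that(3,4) satP[of S] unsat(3)[OF S]
    unfolding left[OF S(2)] right[OF S(2)] zero[OF S(2) Q] zero[OF S(2) Q'] by metis
  show "cut_face I Q (C, D) (sign_face I h) = sign_face I ?g"
    unfolding cut_face_def prod.case
  proof (rule the_equality)
    show "sign_face I ?g \<in> faces_on I Q \<and> (\<forall>S. S \<noteq> {} \<and> S \<subset> I \<longrightarrow> ?spec (sign_face I ?g) S)"
      using mem spec by blast
    fix Y assume Y: "Y \<in> faces_on I Q \<and> (\<forall>S. S \<noteq> {} \<and> S \<subset> I \<longrightarrow> ?spec Y S)"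
    show "Y = sign_face I ?g"
    proof (rule adjoint_face_eqI[of _ I])
      fix S assume "S \<noteq> {}" "S \<subset> I"
      then show "face_sign Y S = face_sign (sign_face I ?g) S"
        using determined[of S Y "sign_face I ?g"] Y spec by blast
    qed (use Y mem in \<open>auto simp: faces_on_def\<close>)
  qed
qed

text \<open>The bound on \<open>e\<close> is asked for all \<open>S\<close> at once so that the
  truncated point inherits it: its sums are sums of \<open>h\<close> over other subsets.\<close>

lemma cut_facesE:
  assumes fin: "finite I" and Q: "partition_on I Q" and V: "valid_cut Q (C, D)"
    and X: "X \<in> faces_on I (cut_target Q (C, D))"
  obtains h c d e where "generic_point I (cut_target Q (C, D)) h" "X = sign_face I h"
    "c \<in> C" "d \<in> D" "e > 0" "\<forall>S. S \<subset> I \<longrightarrow> sum h S \<noteq> 0 \<longrightarrow> e < \<bar>sum h S\<bar>"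
proof -
  obtain h where h: "generic_point I (cut_target Q (C, D)) h" "X = sign_face I h"
    using X unfolding faces_on_eq[OF fin partition_on_cut_target[OF Q V]] by blast
  obtain c d where cd: "c \<in> C" "d \<in> D" using V by (auto simp: valid_cut_def)
  \<comment> \<open>The constant function 1 has sum \<open>card S\<close>, which is at least 1
    whenever \<open>sum h S\<close> is nonzero, so \<open>e\<close> itself obeys the bound.\<close>
  obtain e where e: "e > 0"
      "\<And>S. S \<subseteq> I \<Longrightarrow> sum h S \<noteq> 0 \<Longrightarrow> e * \<bar>sum (\<lambda>i. 1) S\<bar> < \<bar>sum h S\<bar>"
    using ex_small_perturbation[OF fin] by metis
  have "e < \<bar>sum h S\<bar>" if "S \<subset> I" "sum h S \<noteq> 0" for S
  proof -
    have "card S \<noteq> 0" using that by (metis card_0_eq fin finite_subset psubset_imp_subset sum.empty)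
    then have "e * 1 \<le> e * real (card S)" using e(1) by (intro mult_left_mono) auto
    also have "\<dots> < \<bar>sum h S\<bar>" using e(2)[of S] that by auto
    finally show ?thesis by simp
  qed
  then show thesis using h cd e(1) that by blast
qed

lemma cut_face_mem:
  assumes fin: "finite I" and Q: "partition_on I Q" and V: "valid_cut Q (C, D)"
    and X: "X \<in> faces_on I (cut_target Q (C, D))"
  shows "cut_face I Q (C, D) X \<in> faces_on I Q"
proof -
  obtain h c d e where h: "generic_point I (cut_target Q (C, D)) h" "X = sign_face I h"
    and cd: "c \<in> C" "d \<in> D"
    and e: "e > 0" "\<forall>S. S \<subset> I \<longrightarrow> sum h S \<noteq> 0 \<longrightarrow> e < \<bar>sum h S\<bar>"
    using assms by (rule cut_facesE) (rule that)
  note cut = cut_face_sign_face[OF fin Q V h(1) cd e]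
  show ?thesis using cut(2) unfolding h(2) cut(1) faces_on_eq[OF fin Q] by (intro imageI CollectI)
qed

lemma partition_at_cut_target:
  assumes V: "valid_cut Q (C, D)" and S: "C \<union> D \<subseteq> S"
  shows "partition_at I (cut_target Q (C, D)) S = cut_target (partition_at I Q S) (C, D)"
proof -
  \<comment> \<open>The cut must not remove one of the added singletons; \<open>C \<union> D\<close>
    has two points.\<close>
  obtain c d where "c \<in> C" "d \<in> D" "c \<noteq> d" using V by (auto simp: valid_cut_def)
  then have "C \<union> D \<noteq> {i}" for i by (metis UnCI singletonD)
  then have "C \<union> D \<notin> (\<lambda>i. {i}) ` (I - S)" by fast
  then show ?thesis using S unfolding partition_at_def cut_target_def by auto
qed

lemma partition_at_cut_target_disjoint:
  assumes V: "valid_cut Q (C, D)" and B: "(C \<union> D) \<inter> B = {}"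
  shows "partition_at I (cut_target Q (C, D)) B = partition_at I Q B"
  using assms by (auto simp: partition_at_def cut_target_def valid_cut_def)

text \<open>If \<open>c\<close> and \<open>d\<close> lie in \<open>B\<close>, truncation commutes
  with the tilt; if both lie outside, truncation erases it. As \<open>B\<close> is saturated and
  \<open>C \<union> D\<close> is a block of \<open>Q\<close>, no third case occurs.\<close>

lemma face_restrict_cut_face:
  assumes fin: "finite I" and Q: "partition_on I Q" and V: "valid_cut Q (C, D)"
    and X: "X \<in> faces_on I (cut_target Q (C, D))" and B: "B \<subseteq> I" "saturated Q B"
  shows "C \<union> D \<subseteq> B \<Longrightarrow> face_restrict I Q (cut_face I Q (C, D) X) B
       = cut_face I (partition_at I Q B) (C, D) (face_restrict I (cut_target Q (C, D)) X B)"
    and "(C \<union> D) \<inter> B = {} \<Longrightarrow> face_restrict I Q (cut_face I Q (C, D) X) B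
       = face_restrict I (cut_target Q (C, D)) X B"
proof -
  let ?Q = "cut_target Q (C, D)"
  have Q': "partition_on I ?Q" using partition_on_cut_target Q V by blast
  have B': "saturated ?Q B"
    using B V unfolding saturated_def cut_target_def valid_cut_def by fast
  obtain h c d e where h: "generic_point I ?Q h" "X = sign_face I h" and cd: "c \<in> C" "d \<in> D"
    and e: "e > 0" and e': "\<forall>S. S \<subset> I \<longrightarrow> sum h S \<noteq> 0 \<longrightarrow> e < \<bar>sum h S\<bar>"
    using fin Q V X by (rule cut_facesE) (rule that)
  note cut = cut_face_sign_face[OF fin Q V h(1) cd e e']
  have L: "face_restrict I Q (cut_face I Q (C, D) X) B = sign_face I (zero_outside B (tilt h e c d))"
    unfolding h(2) cut(1) by (rule face_restrict_sign_face(1)[OF fin Q B cut(2)])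
  have R: "face_restrict I ?Q X B = sign_face I (zero_outside B h)"
    using face_restrict_sign_face(1)[OF fin Q' B(1) B' h(1)] by (simp add: h(2))
  {
    assume CD: "C \<union> D \<subseteq> B"
    have "valid_cut (partition_at I Q B) (C, D)"
      using V CD by (auto simp: valid_cut_def partition_at_def)
    moreover have "generic_point I (cut_target (partition_at I Q B) (C, D)) (zero_outside B h)"
      using generic_point_zero_outside[OF fin Q' B(1) B' h(1)]
        partition_at_cut_target[OF V CD, of I] by simp
    moreover have "\<forall>S. S \<subset> I \<longrightarrow> sum (zero_outside B h) S \<noteq> 0 \<longrightarrow> e < \<bar>sum (zero_outside B h) S\<bar>"
    proof (intro allI impI)
      fix S assume S: "S \<subset> I" "sum (zero_outside B h) S \<noteq> 0"
      then have "finite S" using fin by (auto intro: finite_subset)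
      then show "e < \<bar>sum (zero_outside B h) S\<bar>"
        using S e'[rule_format, of "S \<inter> B"] by (auto simp: sum_zero_outside)
    qed
    ultimately have "cut_face I (partition_at I Q B) (C, D) (sign_face I (zero_outside B h))
        = sign_face I (tilt (zero_outside B h) e c d)"
      by (intro cut_face_sign_face(1)[OF fin partition_on_partition_at[OF Q B] _ _ cd e])
    moreover have "tilt (zero_outside B h) e c d = zero_outside B (tilt h e c d)"
      using CD cd by (auto simp: tilt_def zero_outside_def fun_eq_iff)
    ultimately show "face_restrict I Q (cut_face I Q (C, D) X) B
       = cut_face I (partition_at I Q B) (C, D) (face_restrict I ?Q X B)"
      by (simp add: L R)
  next
    assume "(C \<union> D) \<inter> B = {}"
    then have "zero_outside B (tilt h e c d) = zero_outside B h"
      using cd by (auto simp: tilt_def zero_outside_def fun_eq_iff)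
    then show "face_restrict I Q (cut_face I Q (C, D) X) B = face_restrict I ?Q X B"
      by (simp add: L R)
  }
qed

section \<open>Derivatives of products\<close>

lemma functional_cong:
  "(\<And>b. b \<in> B \<Longrightarrow> g b = h b) \<Longrightarrow> functional B g = functional B h"
  unfolding functional_def by (intro ext if_cong sum.cong refl) (auto simp: free_space_def)

lemma prod_on_pure_cong:
  "(\<And>B. B \<in> P \<Longrightarrow> f B = g B) \<Longrightarrow> prod_on_pure I P Q f = prod_on_pure I P Q g"
  unfolding prod_on_pure_def by (intro functional_cong prod.cong) auto

definition refines :: "'a set set \<Rightarrow> 'a set set \<Rightarrow> bool"
  where "refines Q P \<longleftrightarrow> (\<forall>B\<in>Q. \<exists>S\<in>P. B \<subseteq> S)"

lemma refines_saturated: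
  assumes "partition_on I P" "refines Q P" "S \<in> P"
  shows "saturated Q S"
  unfolding saturated_def
proof
  fix B assume "B \<in> Q"
  then obtain S' where "S' \<in> P" "B \<subseteq> S'" using assms by (auto simp: refines_def)
  then show "B \<subseteq> S \<or> B \<inter> S = {}"
    using partition_on_block_unique[OF assms(1) assms(3), of S'] by blast
qed

text \<open>Both sides are functionals on the same space, so their values at a face \<open>X\<close>
  suffice. The two orientations of the cut affect only the factor at \<open>S\<close> and share all
  others, so their difference factors; unlike in a product rule, no sum over factors arises.\<close>

lemma cut_deriv_prod_on_pure:
  assumes fin: "finite I" and P: "partition_on I P" and Q: "partition_on I Q"
    and QP: "refines Q P" and V: "valid_cut Q (C, D)" and S: "S \<in> P" "C \<union> D \<subseteq> S"
  shows "cut_deriv I Q (C, D) (prod_on_pure I P Q f)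
       = prod_on_pure I P (cut_target Q (C, D))
           (f(S := cut_deriv I (partition_at I Q S) (C, D) (f S)))"
  unfolding prod_on_pure_def[of I P "cut_target Q (C, D)"] cut_deriv_def[of I Q]
proof (rule functional_cong)
  let ?Q = "cut_target Q (C, D)"
  let ?f' = "f(S := cut_deriv I (partition_at I Q S) (C, D) (f S))"
  fix X assume X: "X \<in> faces_on I ?Q"
  have Q': "partition_on I ?Q" using partition_on_cut_target Q V by blast
  note V' = valid_cut_swap[OF V]
  have fP: "finite P" using fin P by (rule finite_elements)
  have BI: "B \<subseteq> I" if "B \<in> P" for B using that P by (auto simp: partition_on_def)
  note sat = refines_saturated[OF P QP]
  have restrict_mem: "face_restrict I ?Q X B \<in> faces_on I (partition_at I ?Q B)" if "B \<in> P" for B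
  proof -
    have "saturated ?Q B"
      using sat[OF that] V unfolding saturated_def cut_target_def valid_cut_def by fast
    then show ?thesis
      using X face_restrict_sign_face[OF fin Q' BI[OF that]] unfolding faces_on_eq[OF fin Q'] by auto
  qed
  have disj: "(C \<union> D) \<inter> B = {}" if "B \<in> P" "B \<noteq> S" for B
    using partition_on_block_unique[OF P S(1) that(1)] S(2) that(2) by blast
  let ?R = "\<Prod>B\<in>P - {S}. f B (basis_vec (face_restrict I ?Q X B))"
  let ?Y = "face_restrict I ?Q X S"
  \<comment> \<open>Stated for any cut with the same union and target, so that both orientations get
    the common cofactor \<open>?R\<close>.\<close>
  have expand: "prod_on_pure I P Q f (basis_vec (cut_face I Q (A, A') X)) =
      f S (basis_vec (cut_face I (partition_at I Q S) (A, A') ?Y)) * ?R"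
    if A: "valid_cut Q (A, A')" "A \<union> A' = C \<union> D" "cut_target Q (A, A') = ?Q" for A A'
  proof -
    have X': "X \<in> faces_on I (cut_target Q (A, A'))" using X A by simp
    note r = face_restrict_cut_face[OF fin Q A(1) X', unfolded A(2,3)]
    have "prod_on_pure I P Q f (basis_vec (cut_face I Q (A, A') X)) =
        (\<Prod>B\<in>P. f B (basis_vec (face_restrict I Q (cut_face I Q (A, A') X) B)))"
      unfolding prod_on_pure_def by (rule functional_basis_vec, rule cut_face_mem[OF fin Q A(1) X'])
    also have "\<dots> = f S (basis_vec (cut_face I (partition_at I Q S) (A, A') ?Y)) *
        (\<Prod>B\<in>P - {S}. f B (basis_vec (face_restrict I Q (cut_face I Q (A, A') X) B)))"
      using r(1)[OF BI[OF S(1)] sat[OF S(1)] S(2)] by (simp add: prod.remove[OF fP S(1)])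
    also have "\<dots> = f S (basis_vec (cut_face I (partition_at I Q S) (A, A') ?Y)) * ?R"
      using r(2) BI sat disj by (intro arg_cong2[where f = "(*)"] prod.cong refl) auto
    finally show ?thesis .
  qed
  have "cut_deriv I (partition_at I Q S) (C, D) (f S) (basis_vec ?Y)
      = f S (basis_vec (cut_face I (partition_at I Q S) (C, D) ?Y))
      - f S (basis_vec (cut_face I (partition_at I Q S) (D, C) ?Y))"
    using restrict_mem[OF S(1)] unfolding cut_deriv_def partition_at_cut_target[OF V S(2)]
    by (simp add: functional_basis_vec)
  then have "(\<Prod>B\<in>P. ?f' B (basis_vec (face_restrict I ?Q X B)))
      = (f S (basis_vec (cut_face I (partition_at I Q S) (C, D) ?Y))
        - f S (basis_vec (cut_face I (partition_at I Q S) (D, C) ?Y))) * ?R"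
    by (simp add: prod.remove[OF fP S(1)])
  then show "prod_on_pure I P Q f (basis_vec (cut_face I Q (C, D) X))
      - prod_on_pure I P Q f (basis_vec (cut_face I Q (prod.swap (C, D)) X))
      = (\<Prod>B\<in>P. ?f' B (basis_vec (face_restrict I ?Q X B)))"
    using expand[OF V] expand[OF V' Un_commute cut_target_swap[of Q D C]]
    by (simp add: left_diff_distrib)
qed

section \<open>Iterated cuts\<close>

primrec valid_cuts :: "'a set set \<Rightarrow> ('a set \<times> 'a set) list \<Rightarrow> bool" where
  "valid_cuts Q [] \<longleftrightarrow> True"
| "valid_cuts Q (V # Vs) \<longleftrightarrow> valid_cut Q V \<and> valid_cuts (cut_target Q V) Vs"

text \<open>The layering restricted to the tree over \<open>S\<close>, expressed by containment of
  the cut block so that inductions over lists of cuts need not refer to trees.\<close>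

definition cuts_in :: "'a set \<Rightarrow> ('a set \<times> 'a set) list \<Rightarrow> ('a set \<times> 'a set) list"
  where "cuts_in S = filter (\<lambda>V. fst V \<union> snd V \<subseteq> S)"

text \<open>The partition \<open>P\<close> stays fixed while \<open>Q\<close> is refined and
  \<open>f\<close> is updated at one block, so both vary in the induction. Refinement places each
  cut inside a single block of \<open>P\<close>.\<close>

lemma cuts_deriv_prod_on_pure:
  assumes fin: "finite I" and P: "partition_on I P" and "partition_on I Q" "refines Q P" "valid_cuts Q Vs"
  shows "cuts_deriv I Q Vs (prod_on_pure I P Q f)
       = prod_on_pure I P (foldl cut_target Q Vs)
           (\<lambda>S. cuts_deriv I (partition_at I Q S) (cuts_in S Vs) (f S))"
  using assms(3-5)
proof (induction Vs arbitrary: Q f)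
  case (Cons V Vs)
  obtain C D where V: "V = (C, D)" by fastforce
  have CD: "valid_cut Q (C, D)" using Cons.prems V by simp
  then obtain S where S: "S \<in> P" "C \<union> D \<subseteq> S"
    using Cons.prems unfolding refines_def valid_cut_def by fast
  let ?Q = "cut_target Q (C, D)"
  have Q': "partition_on I ?Q" using partition_on_cut_target Cons.prems CD by blast
  have ref: "refines ?Q P"
    using Cons.prems S unfolding refines_def cut_target_def by auto
  have "cuts_deriv I Q (V # Vs) (prod_on_pure I P Q f)
      = cuts_deriv I ?Q Vs (prod_on_pure I P ?Q
          (f(S := cut_deriv I (partition_at I Q S) (C, D) (f S))))"
    unfolding V cuts_deriv.simps cut_deriv_prod_on_pure[OF fin P Cons.prems(1,2) CD S] by simp
  also have "\<dots> = prod_on_pure I P (foldl cut_target ?Q Vs)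
      (\<lambda>B. cuts_deriv I (partition_at I ?Q B) (cuts_in B Vs)
        ((f(S := cut_deriv I (partition_at I Q S) (C, D) (f S))) B))"
    using Cons.IH[OF Q' ref] Cons.prems V by simp
  also have "\<dots> = prod_on_pure I P (foldl cut_target Q (V # Vs))
      (\<lambda>B. cuts_deriv I (partition_at I Q B) (cuts_in B (V # Vs)) (f B))"
    unfolding V foldl_Cons
  proof (rule prod_on_pure_cong)
    fix B assume B: "B \<in> P"
    show "cuts_deriv I (partition_at I ?Q B) (cuts_in B Vs)
        ((f(S := cut_deriv I (partition_at I Q S) (C, D) (f S))) B)
      = cuts_deriv I (partition_at I Q B) (cuts_in B ((C, D) # Vs)) (f B)"
    proof (cases "B = S")
      case True
      then show ?thesis using S partition_at_cut_target[OF CD] by (simp add: cuts_in_def)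
    next
      case False
      then have disj: "(C \<union> D) \<inter> B = {}"
        using partition_on_block_unique[OF P S(1) B] S(2) by blast
      \<comment> \<open>Being nonempty, the cut block cannot lie in a \<open>B\<close> that it
        misses, so the list for \<open>B\<close> drops this cut.\<close>
      then have "\<not> C \<union> D \<subseteq> B" using CD by (auto simp: valid_cut_def)
      then have "cuts_in B ((C, D) # Vs) = cuts_in B Vs" by (simp add: cuts_in_def)
      then show ?thesis
        using False partition_at_cut_target_disjoint[OF CD disj] by simp
    qed
  qed
  finally show ?case .
qed (simp add: cuts_in_def)

text \<open>Identifies the codomain of the derivative of the factor at \<open>B\<close>, so that the
  family of derivatives lands in the spaces of the target tensor product.\<close>

lemma foldl_cut_target_partition_at:
  assumes P: "partition_on I P" and "partition_on I Q" "refines Q P" "valid_cuts Q Vs" and B: "B \<in> P"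
  shows "foldl cut_target (partition_at I Q B) (cuts_in B Vs)
       = partition_at I (foldl cut_target Q Vs) B"
  using assms(2-4)
proof (induction Vs arbitrary: Q)
  case (Cons V Vs)
  obtain C D where V: "V = (C, D)" by fastforce
  have CD: "valid_cut Q (C, D)" using Cons.prems V by simp
  then obtain S where S: "S \<in> P" "C \<union> D \<subseteq> S"
    using Cons.prems unfolding refines_def valid_cut_def by fast
  let ?Q = "cut_target Q (C, D)"
  have Q': "partition_on I ?Q" using partition_on_cut_target Cons.prems CD by blast
  have ref: "refines ?Q P"
    using Cons.prems S unfolding refines_def cut_target_def by auto
  have IH: "foldl cut_target (partition_at I ?Q B) (cuts_in B Vs)
       = partition_at I (foldl cut_target ?Q Vs) B"
    using Cons.IH[OF Q' ref] Cons.prems V by simp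
  show ?case
  proof (cases "B = S")
    case True
    then show ?thesis using IH S partition_at_cut_target[OF CD, of S I] by (simp add: cuts_in_def V)
  next
    case False
    then have disj: "(C \<union> D) \<inter> B = {}"
      using partition_on_block_unique[OF P S(1) B] S(2) by blast
    then have "\<not> C \<union> D \<subseteq> B" using CD by (auto simp: valid_cut_def)
    then have "cuts_in B (V # Vs) = cuts_in B Vs" by (simp add: cuts_in_def V)
    then show ?thesis
      using IH partition_at_cut_target_disjoint[OF CD disj, of I] by (simp add: V)
  qed
qed (simp add: cuts_in_def)

section \<open>Forests as sequences of cuts\<close>

abbreviation support :: "'a tree \<Rightarrow> 'a set"
  where "support t \<equiv> \<Union>(set (leaf_labels t))"

text \<open>A set of trees without indexing blocks: cutting a root replaces one tree by two, and the
  supports serve as the blocks.\<close>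

definition forest_set :: "'a tree set \<Rightarrow> bool"
  where "forest_set TS \<longleftrightarrow> (\<forall>t\<in>TS. tree_over (support t) t)
     \<and> (\<forall>t\<in>TS. \<forall>u\<in>TS. t \<noteq> u \<longrightarrow> support t \<inter> support u = {})"

lemma leaf_labels_nonempty: "leaf_labels t \<noteq> []"
  by (induction t) auto

lemma support_nonempty: "tree_over (support t) t \<Longrightarrow> support t \<noteq> {}"
  using leaf_labels_nonempty[of t] unfolding tree_over_def partition_on_def
  by (cases "leaf_labels t") auto

text \<open>Distinctness of labels separates the subtrees: the set of labels alone would not notice
  a block occurring on both sides.\<close>

lemma tree_over_Node:
  assumes "tree_over (support (Node l r)) (Node l r)"
  shows "tree_over (support l) l" "tree_over (support r) r" "support l \<inter> support r = {}"
proof -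
  have dj: "disjoint (set (leaf_labels l) \<union> set (leaf_labels r))"
    and ne: "{} \<notin> set (leaf_labels l) \<union> set (leaf_labels r)"
    and di: "distinct (leaf_labels l @ leaf_labels r)"
    using assms by (auto simp: tree_over_def partition_on_def)
  show "tree_over (support l) l" "tree_over (support r) r"
    using dj ne di unfolding tree_over_def partition_on_def disjoint_def by auto
  show "support l \<inter> support r = {}"
  proof (rule ccontr)
    assume "support l \<inter> support r \<noteq> {}"
    then obtain x A B where "x \<in> A" "x \<in> B" "A \<in> set (leaf_labels l)" "B \<in> set (leaf_labels r)"
      by blast
    moreover from this have "A \<noteq> B" using di by auto
    ultimately show False using dj unfolding disjoint_def by blast
  qed
qed

lemma support_node: "n \<in> nodes t \<Longrightarrow> support n \<subseteq> support t"
  by (induction t) auto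

lemma tree_over_node:
  "tree_over (support t) t \<Longrightarrow> n \<in> nodes t \<Longrightarrow> tree_over (support n) n"
proof (induction t)
  case (Node l r)
  then show ?case using tree_over_Node[OF Node.prems(1)] by auto
qed simp

lemma size_node: "n \<in> nodes t \<Longrightarrow> size n \<le> size t"
  by (induction t) auto

lemma node_self: "n \<in> nodes t \<Longrightarrow> n \<in> nodes n"
  by (induction t) auto

lemma node_cut_support: "n \<in> nodes t \<Longrightarrow> fst (node_cut n) \<union> snd (node_cut n) = support n"
  by (cases n; use node_self in force)

text \<open>Since a node precedes its descendants, the first node in the layering is the root of its
  tree; cutting there leaves the forest in which this tree is replaced by its two subtrees.\<close>

lemma valid_cuts_forest:
  assumes "forest_set TS" "distinct ns" "set ns = (\<Union>t\<in>TS. nodes t)"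
    "sorted_wrt (\<lambda>a b. a \<notin> nodes b) ns"
  shows "valid_cuts (support ` TS) (map node_cut ns) \<and>
    foldl cut_target (support ` TS) (map node_cut ns) = (\<Union>t\<in>TS. set (leaf_labels t))"
  using assms
proof (induction ns arbitrary: TS)
  case Nil
  \<comment> \<open>Without nodes all trees are sticks, whose only label is their support.\<close>
  have "set (leaf_labels t) = {support t}" if "t \<in> TS" for t
    using Nil(3) that by (cases t) auto
  then have "(\<Union>t\<in>TS. set (leaf_labels t)) = (\<Union>t\<in>TS. {support t})" by (rule SUP_cong[OF refl])
  then show ?case by auto
next
  case (Cons n ns)
  obtain t where t: "t \<in> TS" "n \<in> nodes t" using Cons.prems(3) by auto
  then have "t \<in> nodes t" by (cases t) auto
  then have "t \<in> set (n # ns)" using t Cons.prems(3) by blast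
  \<comment> \<open>Were \<open>t\<close> later in the list, the head \<open>n\<close> would be a
    node of a later entry, against the order.\<close>
  then have nt: "n = t" using t Cons.prems(4) by auto
  then obtain l r where lr: "t = Node l r" using t by (cases t) auto
  have over: "tree_over (support t) t" using t Cons.prems(1) by (simp add: forest_set_def)
  note sub = tree_over_Node[OF over[unfolded lr]]
  note ne = support_nonempty[OF sub(1)] support_nonempty[OF sub(2)]
  have dis: "support t \<inter> support u = {}" if "u \<in> TS" "u \<noteq> t" for u
    using that t Cons.prems(1) unfolding forest_set_def by blast
  have ldis: "support l \<inter> support u = {}" "support r \<inter> support u = {}" if "u \<in> TS" "u \<noteq> t" for u
    using dis[OF that] by (auto simp: lr)
  let ?TS = "TS - {t} \<union> {l, r}"
  have fs: "forest_set ?TS"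
    using Cons.prems(1) sub ldis unfolding forest_set_def by blast
  have ncut: "node_cut n = (support l, support r)" by (simp add: nt lr)
  have union: "support l \<union> support r = support t" by (auto simp: lr)
  \<comment> \<open>Nonempty disjoint supports are distinct, so removing a tree removes exactly its
    block.\<close>
  have "support ` (TS - {t}) = support ` TS - {support t}"
  proof -
    have "support t \<noteq> {}" using over by (rule support_nonempty)
    then have "support u \<noteq> support t" if "u \<in> TS - {t}" for u
      using dis[of u] that by auto
    then have "support t \<notin> support ` (TS - {t})" by fastforce
    then show ?thesis by blast
  qed
  then have target: "cut_target (support ` TS) (node_cut n) = support ` ?TS"
    by (auto simp: ncut cut_target_def union)
  have valid: "valid_cut (support ` TS) (node_cut n)"
    using t(1) union sub(3) ne by (auto simp: ncut valid_cut_def)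
  \<comment> \<open>Size excludes \<open>t\<close> from its own subtrees, disjointness of supports
    from the other trees; hence the remaining list enumerates the nodes of the new forest.\<close>
  have "t \<notin> nodes u" if u: "u \<in> ?TS" for u
  proof
    assume tu: "t \<in> nodes u"
    then have "size t \<le> size u" by (rule size_node)
    then have "u \<noteq> l" "u \<noteq> r" by (auto simp: lr)
    then have "support t \<inter> support u = {}" using u dis by blast
    moreover have "support t \<noteq> {}" using over by (rule support_nonempty)
    ultimately show False using support_node[OF tu] by blast
  qed
  then have "set ns = (\<Union>u\<in>?TS. nodes u)"
  proof -
    have "insert t (\<Union>u\<in>?TS. nodes u) = (\<Union>u\<in>TS. nodes u)" using t(1) by (auto simp: lr)
    then have "insert t (set ns) = insert t (\<Union>u\<in>?TS. nodes u)" using Cons.prems(3) nt by simp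
    moreover have "t \<notin> set ns" using Cons.prems(2) nt by simp
    moreover have "t \<notin> (\<Union>u\<in>?TS. nodes u)" using \<open>\<And>u. u \<in> ?TS \<Longrightarrow> t \<notin> nodes u\<close> by blast
    ultimately show ?thesis by (metis insert_ident)
  qed
  then have IH: "valid_cuts (support ` ?TS) (map node_cut ns) \<and>
    foldl cut_target (support ` ?TS) (map node_cut ns) = (\<Union>t\<in>?TS. set (leaf_labels t))"
    using Cons.prems fs by (intro Cons.IH) auto
  moreover have "(\<Union>t\<in>?TS. set (leaf_labels t)) = (\<Union>t\<in>TS. set (leaf_labels t))"
    using t(1) by (auto simp: lr)
  ultimately show ?case using valid target by simp
qed

text \<open>The layering gives the order condition by contraposition. A node of another tree has its
  nonempty support in another block of \<open>P\<close>, so filtering nodes by tree and cuts by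
  containment in \<open>S\<close> agree.\<close>

lemma layered_forest_cuts:
  assumes "layered_forest I P Q (T, ns)"
  shows "valid_cuts P (map node_cut ns)" "foldl cut_target P (map node_cut ns) = Q"
    and "S \<in> P \<Longrightarrow> map node_cut (snd (forest_at (T, ns) S)) = cuts_in S (map node_cut ns)"
proof -
  have P: "partition_on I P" and T: "\<And>S. S \<in> P \<Longrightarrow> tree_over S (T S)"
    and Q: "Q = (\<Union>S\<in>P. set (leaf_labels (T S)))"
    and ns: "distinct ns" "set ns = (\<Union>S\<in>P. nodes (T S))"
    and lay: "\<And>i j. i < length ns \<Longrightarrow> j < length ns \<Longrightarrow> ns ! j \<in> nodes (ns ! i) \<Longrightarrow> i \<le> j"
    using assms by (auto simp: layered_forest_def)
  have sup: "support (T S) = S" if "S \<in> P" for S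
    using T[OF that] by (simp add: tree_over_def partition_on_def)
  have "sorted_wrt (\<lambda>a b. a \<notin> nodes b) ns"
    unfolding sorted_wrt_iff_nth_less using lay by (meson less_trans not_le)
  moreover have "forest_set (T ` P)"
    using T partition_on_block_unique[OF P] unfolding forest_set_def by (auto simp: sup)
  moreover have "support ` T ` P = P" by (simp add: image_image sup cong: image_cong)
  ultimately show "valid_cuts P (map node_cut ns)" "foldl cut_target P (map node_cut ns) = Q"
    using valid_cuts_forest[of "T ` P" ns] ns unfolding Q by (simp_all add: image_image)
  assume S: "S \<in> P"
  have "n \<in> nodes (T S) \<longleftrightarrow> fst (node_cut n) \<union> snd (node_cut n) \<subseteq> S" if n: "n \<in> set ns" for n
  proof -
    obtain S' where S': "S' \<in> P" "n \<in> nodes (T S')" using n ns by auto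
    have cut: "fst (node_cut n) \<union> snd (node_cut n) = support n" using S'(2) by (rule node_cut_support)
    have "support n \<subseteq> S'" using support_node[OF S'(2)] sup[OF S'(1)] by simp
    moreover have "support n \<noteq> {}"
      using support_nonempty[OF tree_over_node[OF _ S'(2)]] T[OF S'(1)] sup[OF S'(1)] by simp
    ultimately have "support n \<subseteq> S \<Longrightarrow> S = S'"
      using partition_on_block_unique[OF P S S'(1)] by blast
    then show ?thesis unfolding cut using S' support_node[of n "T S"] sup[OF S] by auto
  qed
  then show "map node_cut (snd (forest_at (T, ns) S)) = cuts_in S (map node_cut ns)"
    by (auto simp: forest_at_def cuts_in_def filter_map comp_def intro!: arg_cong[where f = "map _"] filter_cong)
qed

section \<open>Linearity\<close>

text \<open>The defining sum runs over the support, which varies with the vector; \<open>eq\<close>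
  moves it to a common finite superset.\<close>

lemma functional_in_dual: "functional B g \<in> dual_space (free_space B)"
proof -
  have eq: "functional B g x = (\<Sum>b\<in>A. x b * g b)"
    if "x \<in> free_space B" "finite A" "{b. x b \<noteq> 0} \<subseteq> A" for x A
    using that unfolding functional_def by (auto intro!: sum.mono_neutral_left)
  have "functional B g (x + y) = functional B g x + functional B g y"
    if xy: "x \<in> free_space B" "y \<in> free_space B" for x y
  proof -
    let ?A = "{b. x b \<noteq> 0} \<union> {b. y b \<noteq> 0}"
    have "finite ?A" using xy by (auto simp: free_space_def)
    moreover have "x + y \<in> free_space B"
      using xy subspace_free_space[of B] by (rule fun_vs.subspace_add[rotated])
    moreover have "{b. (x + y) b \<noteq> 0} \<subseteq> ?A" by auto
    ultimately have "functional B g (x + y) = (\<Sum>b\<in>?A. (x + y) b * g b)" by (intro eq)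
    then show ?thesis
      using eq[of x ?A] eq[of y ?A] xy \<open>finite ?A\<close> by (simp add: distrib_right sum.distrib)
  qed
  moreover have "functional B g (fscale c x) = c * functional B g x"
    if x: "x \<in> free_space B" for x c
  proof -
    let ?A = "{b. x b \<noteq> 0}"
    have "finite ?A" using x by (auto simp: free_space_def)
    moreover have "fscale c x \<in> free_space B"
      using subspace_free_space[of B] x by (rule fun_vs.subspace_scale)
    ultimately show ?thesis
      using eq[of x ?A] eq[of "fscale c x" ?A] x
      by (auto simp: fscale_def sum_distrib_left mult.assoc)
  qed
  ultimately show ?thesis by (auto simp: dual_space_def functional_def)
qed

lemma cuts_deriv_in_dual:
  "f \<in> L_dual I Q \<Longrightarrow> cuts_deriv I Q Vs f \<in> L_dual I (foldl cut_target Q Vs)"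
  by (induction Vs arbitrary: Q f) (simp_all add: cut_deriv_def functional_in_dual)

text \<open>The derivative uses \<open>f\<close> only through evaluations at basis vectors, which
  are additive in \<open>f\<close>; so it passes through linear combinations without membership
  conditions.\<close>

lemma cut_deriv_add: "cut_deriv I Q V (f + g) = cut_deriv I Q V f + cut_deriv I Q V g"
  unfolding cut_deriv_def functional_add[symmetric] by (rule functional_cong) simp

lemma cut_deriv_scale: "cut_deriv I Q V (fscale c f) = fscale c (cut_deriv I Q V f)"
  unfolding cut_deriv_def functional_scale[symmetric]
  by (rule functional_cong) (simp add: fscale_def right_diff_distrib)

lemma cuts_deriv_add: "cuts_deriv I Q Vs (f + g) = cuts_deriv I Q Vs f + cuts_deriv I Q Vs g"
  by (induction Vs arbitrary: Q f g) (simp_all only: cuts_deriv.simps cut_deriv_add)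

lemma cuts_deriv_scale: "cuts_deriv I Q Vs (fscale c f) = fscale c (cuts_deriv I Q Vs f)"
  by (induction Vs arbitrary: Q f) (simp_all only: cuts_deriv.simps cut_deriv_scale)

section \<open>Linear combinations and representatives of tensors\<close>

lemma linear_lin_comb:
  assumes add: "\<And>f g. L (f + g) = L f + L g" and scale: "\<And>c f. L (fscale c f) = fscale c (L f)"
  shows "L (lin_comb m x) = lin_comb (\<lambda>f. L (m f)) x"
proof -
  have "L 0 = 0" using scale[of 0 0] by simp
  then have "L (\<Sum>f\<in>A. fscale (x f) (m f)) = (\<Sum>f\<in>A. fscale (x f) (L (m f)))" for A
  proof (induction A rule: infinite_finite_induct)
    case (insert a A)
    have "L (\<Sum>f\<in>insert a A. fscale (x f) (m f))
        = L (fscale (x a) (m a)) + L (\<Sum>f\<in>A. fscale (x f) (m f))"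
      using insert.hyps by (simp only: sum.insert add simp_thms)
    then show ?case using insert by (simp only: sum.insert scale simp_thms)
  qed (simp_all only: sum.infinite sum.empty simp_thms)
  then show ?thesis by (simp only: lin_comb_def)
qed

text \<open>The map \<open>\<phi>\<close> may identify indices, so coefficients can merge or cancel.
  Induction over the support of \<open>x\<close> avoids computing them, at the price of carrying
  finiteness of supports along.\<close>

lemma lin_comb_lin_comb_basis_vec:
  assumes "finite {f. x f \<noteq> 0}"
  shows "lin_comb m (lin_comb (\<lambda>f. basis_vec (\<phi> f)) x) = lin_comb (\<lambda>f. m (\<phi> f)) x"
proof -
  have "finite {g. (\<Sum>f\<in>A. fscale (x f) (basis_vec (\<phi> f))) g \<noteq> 0} \<and>
      lin_comb m (\<Sum>f\<in>A. fscale (x f) (basis_vec (\<phi> f))) = (\<Sum>f\<in>A. fscale (x f) (m (\<phi> f)))"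
    if "finite A" for A
    using that
  proof induction
    case empty
    then show ?case by (simp only: sum.empty lin_comb_zero) simp
  next
    case (insert a A)
    then show ?case
      by (simp only: sum.insert lin_comb_add lin_comb_scale finite_supp_add finite_supp_scale
          finite_supp_basis_vec lin_comb_basis_vec simp_thms)
  qed
  then show ?thesis using assms by (simp only: lin_comb_def)
qed

text \<open>Extracting the factor at \<open>j\<close> leaves a cofactor that does not see
  \<open>u\<close>.\<close>

lemma multilinear_on_prod_on_pure:
  assumes P: "finite P"
  shows "multilinear_on P V (prod_on_pure I P Q)"
proof -
  have upd: "(\<Prod>B\<in>P. (f(j := u)) B (g B)) = u (g j) * (\<Prod>B\<in>P - {j}. f B (g B))"
    if "j \<in> P" for f :: "'a set \<Rightarrow> ('a face \<Rightarrow> 'b) \<Rightarrow> 'b" and j u g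
    using P that by (subst prod.remove[of P j]) auto
  show ?thesis
    unfolding multilinear_on_def prod_on_pure_def
    by (simp add: upd distrib_right mult.assoc
        functional_add[symmetric] functional_scale[symmetric] del: fun_upd_apply)
      (simp add: upd fscale_def mult.assoc del: fun_upd_apply)
qed

lemma tensor_rel_refl: "x \<in> free_space (PiE J V) \<Longrightarrow> (x, x) \<in> tensor_rel J V"
  by (simp add: tensor_rel_def tensor_relations_def fun_vs.span_zero)

text \<open>The chosen representative differs from \<open>z\<close> by a combination of relations,
  on which a multilinear map vanishes. General \<open>z\<close> is required because
  \<open>tensor_map\<close> yields the class of a whole combination.\<close>

lemma tensor_lift_class:
  assumes m: "multilinear_on J V m" and z: "z \<in> free_space (PiE J V)"
  shows "tensor_lift m (tensor_rel J V `` {z}) = lin_comb m z"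
proof -
  define y where "y = (SOME y. y \<in> tensor_rel J V `` {z})"
  have "z \<in> tensor_rel J V `` {z}" using tensor_rel_refl[OF z] by blast
  then have "y \<in> tensor_rel J V `` {z}" unfolding y_def by (rule someI[of "\<lambda>y. y \<in> tensor_rel J V `` {z}"])
  then have y: "finite {f. y f \<noteq> 0}" and R: "z - y \<in> tensor_relations J V"
    by (auto simp: tensor_rel_def free_space_def)
  have "lin_comb m (y + (z - y)) = lin_comb m y + 0"
    using lin_comb_add[OF y, of "z - y" m] lin_comb_tensor_relations[OF m R] by metis
  then show ?thesis unfolding tensor_lift_def y_def[symmetric] by simp
qed

lemma tensor_someE:
  assumes "t \<in> tensor J V"
  shows "(SOME x. x \<in> t) \<in> free_space (PiE J V)"
proof -
  obtain z where z: "z \<in> free_space (PiE J V)" "t = tensor_rel J V `` {z}"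
    using assms by (auto simp: tensor_def quotient_def)
  then have "z \<in> t" using tensor_rel_refl by blast
  then have "(SOME x. x \<in> t) \<in> t" by (rule someI[of "\<lambda>x. x \<in> t"])
  then show ?thesis using z by (auto simp: tensor_rel_def)
qed

theorem theorem4p1:
  fixes I :: "'a set" and P Q :: "'a set set" and F :: "'a forest"
    and t :: "(('a set \<Rightarrow> ('a face \<Rightarrow> 'k::field_char_0) \<Rightarrow> 'k) \<Rightarrow> 'k) set"
  assumes "finite I"
    and "layered_forest I P Q F"
    and "t \<in> tensor P (\<lambda>S. L_dual I (singleton_completion I S))"
  shows "forest_deriv I P F (ext_prod I P P t)
       = ext_prod I P Q
           (tensor_map P (\<lambda>S. L_dual I (partition_at I Q S))
              (\<lambda>S. forest_deriv I (singleton_completion I S) (forest_at F S)) t)"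
proof -
  obtain T ns where F: "F = (T, ns)" by fastforce
  note cuts = layered_forest_cuts[OF assms(2)[unfolded F]]
  let ?Vs = "map node_cut ns"
  let ?V = "\<lambda>S. L_dual I (singleton_completion I S) :: (('a face \<Rightarrow> 'k) \<Rightarrow> 'k) set"
  let ?W = "\<lambda>S. L_dual I (partition_at I Q S) :: (('a face \<Rightarrow> 'k) \<Rightarrow> 'k) set"
  let ?D = "\<lambda>S. forest_deriv I (singleton_completion I S) (forest_at F S)
    :: (('a face \<Rightarrow> 'k) \<Rightarrow> 'k) \<Rightarrow> ('a face \<Rightarrow> 'k) \<Rightarrow> 'k"
  have P: "partition_on I P" using assms(2) by (auto simp: layered_forest_def F)
  have fP: "finite P" using assms(1) P by (rule finite_elements)
  have ref: "refines P P" by (auto simp: refines_def)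
  \<comment> \<open>Blocks are nonempty and disjoint, so \<open>S\<close> is the only block of
    \<open>P\<close> inside \<open>S\<close>.\<close>
  have at: "partition_at I P S = singleton_completion I S" if "S \<in> P" for S
  proof -
    have "{B \<in> P. B \<subseteq> S} = {S}"
    proof (intro equalityI subsetI)
      fix B assume "B \<in> {B \<in> P. B \<subseteq> S}"
      moreover from this obtain b where "b \<in> B" using P unfolding partition_on_def by (metis all_not_in_conv mem_Collect_eq)
      ultimately show "B \<in> {S}" using partition_on_block_unique[OF P that] by blast
    qed (use that in auto)
    then show ?thesis by (simp add: partition_at_def singleton_completion_def)
  qed
  have D: "?D S = cuts_deriv I (partition_at I P S) (cuts_in S ?Vs)" if "S \<in> P" for S
    using cuts(3)[OF that] at[OF that] by (simp add: forest_deriv_def F)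
  \<comment> \<open>Both \<open>ext_prod I P P\<close> and \<open>tensor_map\<close> evaluate at
    this same representative of \<open>t\<close>, so independence of the choice is invoked only for
    the image class.\<close>
  define x where "x = (SOME x. x \<in> t)"
  have x: "x \<in> free_space (PiE P ?V)" unfolding x_def by (rule tensor_someE) (rule assms(3))
  then have fx: "finite {f. x f \<noteq> 0}" by (simp add: free_space_def)
  let ?\<phi> = "\<lambda>f. \<lambda>S\<in>P. ?D S (f S)"
  have DW: "?D S f \<in> ?W S" if "S \<in> P" "f \<in> ?V S" for S f
    using cuts_deriv_in_dual[of f I "partition_at I P S" "cuts_in S ?Vs"] that cuts(2)
      foldl_cut_target_partition_at[OF P P ref cuts(1) that(1)]
    by (simp add: D at)
  have z: "lin_comb (\<lambda>f. basis_vec (?\<phi> f)) x \<in> free_space (PiE P ?W)"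
    unfolding lin_comb_def
  proof (intro fun_vs.subspace_sum[OF subspace_free_space] fun_vs.subspace_scale[OF subspace_free_space])
    fix f assume "f \<in> {f. x f \<noteq> 0}"
    then have "f \<in> PiE P ?V" using x by (auto simp: free_space_def)
    then have "?\<phi> f \<in> PiE P ?W" using DW by fastforce
    then show "basis_vec (?\<phi> f) \<in> free_space (PiE P ?W)"
      using finite_supp_basis_vec[of "?\<phi> f"] by (auto simp: free_space_def basis_vec_def)
  qed
  have "forest_deriv I P F (ext_prod I P P t)
      = cuts_deriv I P ?Vs (lin_comb (prod_on_pure I P P) x)"
    by (simp add: forest_deriv_def F ext_prod_def tensor_lift_def x_def)
  also have "\<dots> = lin_comb (\<lambda>f. cuts_deriv I P ?Vs (prod_on_pure I P P f)) x"
    by (rule linear_lin_comb) (rule cuts_deriv_add cuts_deriv_scale)+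
  \<comment> \<open>The product reads a family only on \<open>P\<close>, so the restriction in
    \<open>?\<phi>\<close> is invisible to it.\<close>
  also have "(\<lambda>f. cuts_deriv I P ?Vs (prod_on_pure I P P f)) = (\<lambda>f. prod_on_pure I P Q (?\<phi> f))"
  proof
    fix f :: "'a set \<Rightarrow> ('a face \<Rightarrow> 'k) \<Rightarrow> 'k"
    show "cuts_deriv I P ?Vs (prod_on_pure I P P f) = prod_on_pure I P Q (?\<phi> f)"
      unfolding cuts_deriv_prod_on_pure[OF assms(1) P P ref cuts(1)] cuts(2)
      by (rule prod_on_pure_cong) (simp add: D)
  qed
  also have "lin_comb (\<lambda>f. prod_on_pure I P Q (?\<phi> f)) x
      = lin_comb (prod_on_pure I P Q) (lin_comb (\<lambda>f. basis_vec (?\<phi> f)) x)"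
    using lin_comb_lin_comb_basis_vec[OF fx, of "prod_on_pure I P Q" ?\<phi>] by simp
  also have "\<dots> = ext_prod I P Q (tensor_map P ?W ?D t)"
    unfolding ext_prod_def tensor_map_def
    using tensor_lift_class[OF multilinear_on_prod_on_pure[OF fP] z]
    by (simp add: tensor_lift_def[of _ t] flip: x_def)
  finally show ?thesis .
qed

end
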